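(* Let $\alpha\in\mathbb R$, let $P,Q\in\mathrm{SPD}(m)$, put $S:=P^{-1/2}QP^{-1/2}$, and define $(P_n,Q_n)_{n\ge0}$ by $(P_0,Q_0)=(P,Q)$ and $$(P_{n+1},Q_{n+1})=\bigl(A_\alpha(P_n,Q_n),M_\alpha(P_n,Q_n)\bigr).$$ Let $a_n,m_n:(0,\infty)\to(0,\infty)$ be defined by $a_0(\lambda)=1$, $m_0(\lambda)=\lambda$, and $$a_{n+1}=\left(\frac{a_n^\alpha+m_n^\alpha}{2}\right)^{1/\alpha},\qquad m_{n+1}=\left(\frac{a_n^{-\alpha}+m_n^{-\alpha}}{2}\right)^{-1/\alpha}$$ for $\alpha\ne0$, and by $a_{n+1}=m_{n+1}=\sqrt{a_nm_n}$ for $\alpha=0$. Let $$\delta_n:=\frac12\max_{1\le i\le m}\bigl|\log\lambda_i(P_n^{-1}Q_n)\bigr|,$$ where $\lambda_1(X),\dots,\lambda_m(X)$ denote the eigenvalues of $X$. Then: (1) $P_n\#Q_n=P\#Q$ for all $n\ge0$; (2) $P_n=P^{1/2}a_n(S)P^{1/2}$ and $Q_n=P^{1/2}m_n(S)P^{1/2}$ for all $n\ge0$; (3) $\delta_{n+1}\le\frac{|\alpha|}{2}\delta_n^2$ for all $n\ge0$, and $\delta_{n+1}<\delta_n$ whenever $\delta_n>0$; (4) $P_n\to P\#Q$ and $Q_n\to P\#Q$ as $n\to\infty$, and consequently $A_\alpha\otimes M_\alpha=M_g$ on $\mathrm{SPD}(m)\times\mathrm{SPD}(m)$.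
   Context: $\mathrm{SPD}(m)$ is the manifold of $m\times m$ real symmetric positive-definite matrices with the affine-invariant metric $g_P(X,Y)=\mathrm{tr}(P^{-1}XP^{-1}Y)$, Levi--Civita connection $\nabla^g$, and Euclidean flat connection $\nabla^E$. For $P,Q\in\mathrm{SPD}(m)$, $P\#Q:=P^{1/2}(P^{-1/2}QP^{-1/2})^{1/2}P^{1/2}$; this equals $M_g(P,Q)$, the midpoint of the $\nabla^g$-geodesic joining $P$ and $Q$. For $\alpha\in\mathbb R$ let $\nabla^{(\alpha)}:=\nabla^g+\alpha(\nabla^E-\nabla^g)$, i.e. $(\nabla^{(\alpha)}_XY)_P=DY(P)[X]-\frac{1-\alpha}{2}(XP^{-1}Y+YP^{-1}X)$. $A_\alpha$ and $M_\alpha$ are the geodesic midpoint maps of $\nabla^{(\alpha)}$ and $\nabla^{(-\alpha)}$: the midpoint map of a connection sends $(P,Q)$ to $\gamma(1/2)$, where $\gamma:[0,1]\to\mathrm{SPD}(m)$ is the unique affinely parametrized geodesic from $P$ to $Q$. Explicitly, with $S=P^{-1/2}QP^{-1/2}$, $$A_\alpha(P,Q)=P^{1/2}f_\alpha(S)P^{1/2},\quad M_\alpha(P,Q)=P^{1/2}f_{-\alpha}(S)P^{1/2},$$ where $f_\alpha(S)=\left(\frac{I+S^\alpha}{2}\right)^{1/\alpha}$ for $\alpha\neq0$ and $f_0(S)=S^{1/2}$ (principal positive-definite powers). For a function $f$ on $(0,\infty)$, $f(S)$ is defined by the spectral functional calculus. The Gauss composition $(A_\alpha\otimes M_\alpha)(P,Q)$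 is the common limit of $(P_n)$ and $(Q_n)$, when both converge to the same point. *)

theory Defs
  imports "HOL-Analysis.Analysis"
begin

definition SPD :: "(real^'m^'m) set" where
  "SPD = {P. transpose P = P \<and> (\<forall>x. x \<noteq> 0 \<longrightarrow> 0 < x \<bullet> (P *v x))}"


section \<open>Spectral functional calculus\<close>

definition diag_matrix :: "(real^'m) \<Rightarrow> real^'m^'m" where
  "diag_matrix d = (\<chi> i j. if i = j then d $ i else 0)"

text \<open>For symmetric \<open>S = U ** diag d ** transpose U\<close> with U orthogonal, f(S) is
  \<open>U ** diag (f d) ** transpose U\<close>; this does not
  depend on the diagonalisation, and only the values of f on the spectrum of S matter.\<close>

definition spectral_fun :: "(real \<Rightarrow> real) \<Rightarrow> real^'m^'m \<Rightarrow> real^'m^'m" where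
  "spectral_fun f S = (THE B. \<exists>U d. orthogonal_matrix U \<and>
     S = U ** diag_matrix d ** transpose U \<and>
     B = U ** diag_matrix (\<chi> i. f (d $ i)) ** transpose U)"

definition spd_powr :: "real^'m^'m \<Rightarrow> real \<Rightarrow> real^'m^'m" where
  "spd_powr P r = spectral_fun (\<lambda>x. x powr r) P"

definition geometric_mean :: "real^'m^'m \<Rightarrow> real^'m^'m \<Rightarrow> real^'m^'m"  (infixl \<open>\<sharp>\<close> 70) where
  "P \<sharp> Q = spd_powr P (1/2)
     ** spd_powr (spd_powr P (- (1/2)) ** Q ** spd_powr P (- (1/2))) (1/2)
     ** spd_powr P (1/2)"

text \<open>For P, Q in SPD all eigenvalues of \<open>matrix_inv P ** Q\<close> are real (and positive), so nothing is lost
  by considering real eigenvalues only.\<close>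

definition eigenvalues :: "real^'m^'m \<Rightarrow> real set" where
  "eigenvalues X = {l. \<exists>v. v \<noteq> 0 \<and> X *v v = l *\<^sub>R v}"


section \<open>Connections on SPD\<close>

text \<open>SPD is an open subset of the space of symmetric matrices, so a tangent vector is a symmetric
  matrix and a vector field is a function sending points of SPD to symmetric matrices.
  A connection maps vector fields X, Y to the derivative of Y along X.\<close>

type_synonym 'm vfield = "real^'m^'m \<Rightarrow> real^'m^'m"
type_synonym 'm connection = "'m vfield \<Rightarrow> 'm vfield \<Rightarrow> 'm vfield"

definition affine_invariant_metric :: "real^'m^'m \<Rightarrow> real^'m^'m \<Rightarrow> real^'m^'m \<Rightarrow> real" where
  "affine_invariant_metric P X Y = trace (matrix_inv P ** X ** matrix_inv P ** Y)"

text \<open>The directional derivative DY(P)[X(P)] only involves values of Y near P on the line P + t X(P),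
  which stays in SPD for small t when X(P) is symmetric.\<close>

definition nabla_E :: "'m::finite connection" where
  "nabla_E X Y P = vector_derivative (\<lambda>t. Y (P + t *\<^sub>R X P)) (at 0)"

definition nabla_g :: "'m::finite connection" where
  "nabla_g X Y P = nabla_E X Y P
     - (1/2) *\<^sub>R (X P ** matrix_inv P ** Y P + Y P ** matrix_inv P ** X P)"

definition nabla_alpha :: "real \<Rightarrow> 'm::finite connection" where
  "nabla_alpha \<alpha> X Y P = nabla_g X Y P + \<alpha> *\<^sub>R (nabla_E X Y P - nabla_g X Y P)"

text \<open>The Christoffel map in the global chart is obtained from constant fields.\<close>

definition christoffel :: "'m::finite connection \<Rightarrow> real^'m^'m \<Rightarrow> real^'m^'m \<Rightarrow> real^'m^'m \<Rightarrow> real^'m^'m"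
  where "christoffel D P X Y = D (\<lambda>_. X) (\<lambda>_. Y) P"

text \<open>In the global chart the covariant acceleration of a curve \<open>\<gamma>\<close> is
  \<open>\<gamma>'' + \<Gamma>\<^sub>\<gamma>(\<gamma>', \<gamma>')\<close>. Derivatives at 0 and 1 are one-sided.\<close>

definition affine_geodesic :: "'m::finite connection \<Rightarrow> (real \<Rightarrow> real^'m^'m) \<Rightarrow> bool" where
  "affine_geodesic D \<gamma> \<longleftrightarrow> (\<exists>\<gamma>' \<gamma>''. \<forall>t\<in>{0..1}.
     \<gamma> t \<in> SPD \<and>
     (\<gamma> has_vector_derivative \<gamma>' t) (at t within {0..1}) \<and>
     (\<gamma>' has_vector_derivative \<gamma>'' t) (at t within {0..1}) \<and>
     \<gamma>'' t + christoffel D (\<gamma> t) (\<gamma>' t) (\<gamma>' t) = 0)"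

definition midpoint_map :: "'m::finite connection \<Rightarrow> real^'m^'m \<Rightarrow> real^'m^'m \<Rightarrow> real^'m^'m" where
  "midpoint_map D P Q =
     (THE X. \<exists>\<gamma>. affine_geodesic D \<gamma> \<and> \<gamma> 0 = P \<and> \<gamma> 1 = Q \<and> \<gamma> (1/2) = X)"

definition A_mean :: "real \<Rightarrow> real^'m::finite^'m \<Rightarrow> real^'m^'m \<Rightarrow> real^'m^'m" where
  "A_mean \<alpha> = midpoint_map (nabla_alpha \<alpha>)"

definition M_mean :: "real \<Rightarrow> real^'m::finite^'m \<Rightarrow> real^'m^'m \<Rightarrow> real^'m^'m" where
  "M_mean \<alpha> = midpoint_map (nabla_alpha (- \<alpha>))"

definition M_g :: "real^'m::finite^'m \<Rightarrow> real^'m^'m \<Rightarrow> real^'m^'m" where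
  "M_g = midpoint_map nabla_g"


section \<open>Gauss composition\<close>

primrec gauss_iter :: "('a \<Rightarrow> 'a \<Rightarrow> 'a) \<Rightarrow> ('a \<Rightarrow> 'a \<Rightarrow> 'a) \<Rightarrow> 'a \<Rightarrow> 'a \<Rightarrow> nat \<Rightarrow> 'a \<times> 'a" where
  "gauss_iter A M P Q 0 = (P, Q)"
| "gauss_iter A M P Q (Suc n) =
     (let (X, Y) = gauss_iter A M P Q n in (A X Y, M X Y))"

definition has_gauss_composition ::
    "('a::topological_space \<Rightarrow> 'a \<Rightarrow> 'a) \<Rightarrow> ('a \<Rightarrow> 'a \<Rightarrow> 'a) \<Rightarrow> 'a \<Rightarrow> 'a \<Rightarrow> 'a \<Rightarrow> bool" where
  "has_gauss_composition A M P Q L \<longleftrightarrow>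
     (\<lambda>n. fst (gauss_iter A M P Q n)) \<longlonglongrightarrow> L \<and> (\<lambda>n. snd (gauss_iter A M P Q n)) \<longlonglongrightarrow> L"

definition gauss_composition ::
    "('a::topological_space \<Rightarrow> 'a \<Rightarrow> 'a) \<Rightarrow> ('a \<Rightarrow> 'a \<Rightarrow> 'a) \<Rightarrow> 'a \<Rightarrow> 'a \<Rightarrow> 'a" where
  "gauss_composition A M P Q = (THE L. has_gauss_composition A M P Q L)"


section \<open>\<open>nabla_g\<close> is the Levi-Civita connection of the affine-invariant metric\<close>

lemma bounded_bilinear_matrix_mult:
  "bounded_bilinear ((**) :: real^'m::finite^'m \<Rightarrow> real^'m^'m \<Rightarrow> real^'m^'m)"
  unfolding bilinear_conv_bounded_bilinear[symmetric] bilinear_def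
  by (auto intro!: linearI simp: vec_eq_iff matrix_matrix_mult_def algebra_simps
      sum.distrib sum_distrib_left)

lemma SPD_invertible:
  assumes "P \<in> SPD" shows "invertible P"
proof -
  have "x = 0" if "P *v x = 0" for x
    using assms that by (auto simp: SPD_def)
  then show ?thesis
    by (simp add: invertible_left_inverse matrix_left_invertible_ker)
qed

lemma matrix_inv_left_right:
  fixes A :: "real^'m::finite^'m"
  assumes "invertible A"
  shows "A ** matrix_inv A = mat 1" "matrix_inv A ** A = mat 1"
proof -
  have "A ** matrix_inv A = mat 1 \<and> matrix_inv A ** A = mat 1"
    using assms unfolding invertible_def matrix_inv_def by (rule someI_ex)
  then show "A ** matrix_inv A = mat 1" "matrix_inv A ** A = mat 1" by auto
qed

lemma matrix_inv_cramer:
  fixes A :: "real^'m::finite^'m"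
  assumes "det A \<noteq> 0"
  shows "matrix_inv A = (\<chi> i k. det (\<chi> r c. if c = i then axis k 1 $ r else A $ r $ c) / det A)"
proof -
  have inv: "invertible A" using assms by (simp add: invertible_det_nz)
  have "A *v column k (matrix_inv A) = axis k 1" for k
  proof -
    have "A *v (matrix_inv A *v axis k 1) = axis k 1"
      by (simp add: matrix_vector_mul_assoc matrix_inv_left_right inv)
    then show ?thesis by (simp add: matrix_vector_mult_basis)
  qed
  then have "column k (matrix_inv A)
      = (\<chi> i. det (\<chi> r c. if c = i then axis k 1 $ r else A $ r $ c) / det A)" for k
    using cramer[OF assms, of "column k (matrix_inv A)" "axis k 1"] by simp
  then show ?thesis
    by (simp add: vec_eq_iff column_def)
qed

lemma isCont_det:
  fixes F :: "real \<Rightarrow> real^'m::finite^'m"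
  assumes "\<And>i j. isCont (\<lambda>t. F t $ i $ j) a"
  shows "isCont (\<lambda>t. det (F t)) a"
  unfolding det_def by (intro continuous_intros assms)

lemma isCont_matrix_inv_line:
  fixes P X :: "real^'m::finite^'m"
  assumes "invertible P"
  shows "isCont (\<lambda>t. matrix_inv (P + t *\<^sub>R X)) 0"
    and "eventually (\<lambda>t. det (P + t *\<^sub>R X) \<noteq> 0) (at 0)"
proof -
  have c: "isCont (\<lambda>t. det (P + t *\<^sub>R X)) 0"
    by (rule isCont_det) (auto intro!: continuous_intros)
  have d: "det P \<noteq> 0" using assms by (simp add: invertible_det_nz)
  have "eventually (\<lambda>t. det (P + t *\<^sub>R X) \<noteq> 0) (nhds 0)"
    using tendsto_imp_eventually_ne[OF c[unfolded isCont_def]] d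
    by (simp add: eventually_nhds_conv_at)
  then have e: "eventually (\<lambda>t. matrix_inv (P + t *\<^sub>R X) =
      (\<chi> i k. det (\<chi> r c. if c = i then axis k 1 $ r else (P + t *\<^sub>R X) $ r $ c)
         / det (P + t *\<^sub>R X))) (nhds 0)"
    by eventually_elim (rule matrix_inv_cramer)
  show "eventually (\<lambda>t. det (P + t *\<^sub>R X) \<noteq> 0) (at 0)"
    using \<open>eventually (\<lambda>t. det (P + t *\<^sub>R X) \<noteq> 0) (nhds 0)\<close>
    by (auto simp: eventually_at_filter elim: eventually_mono)
  have "isCont (\<lambda>t. (\<chi> i k. det (\<chi> r c. if c = i then axis k 1 $ r else (P + t *\<^sub>R X) $ r $ c)
         / det (P + t *\<^sub>R X)) :: real^'m^'m) 0"
    unfolding isCont_def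
  proof (intro tendsto_vec_lambda tendsto_divide c[unfolded isCont_def])
    fix i k :: 'm
    have "isCont (\<lambda>t. det (\<chi> r c. if c = i then axis k 1 $ r else (P + t *\<^sub>R X) $ r $ c)) 0"
    proof (rule isCont_det)
      fix r c :: 'm
      show "isCont (\<lambda>t. (\<chi> r c. if c = i then axis k 1 $ r else (P + t *\<^sub>R X) $ r $ c) $ r $ c) 0"
        by (cases "c = i") (auto intro!: continuous_intros)
    qed
    then show "(\<lambda>t. det (\<chi> r c. if c = i then axis k 1 $ r else (P + t *\<^sub>R X) $ r $ c))
      \<midarrow>0\<rightarrow> det (\<chi> r c. if c = i then axis k 1 $ r else (P + 0 *\<^sub>R X) $ r $ c)"
      by (simp only: isCont_def)
  qed (use d in simp)
  then show "isCont (\<lambda>t. matrix_inv (P + t *\<^sub>R X)) 0"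
    using isCont_cong[OF e] by blast
qed

lemma has_vector_derivative_matrix_inv_line:
  fixes P X :: "real^'m::finite^'m"
  assumes "invertible P"
  shows "((\<lambda>t. matrix_inv (P + t *\<^sub>R X)) has_vector_derivative
           - (matrix_inv P ** X ** matrix_inv P)) (at 0)"
proof -
  interpret B: bounded_bilinear "(**) :: real^'m^'m \<Rightarrow> real^'m^'m \<Rightarrow> real^'m^'m"
    by (rule bounded_bilinear_matrix_mult)
  let ?I = "\<lambda>t. matrix_inv (P + t *\<^sub>R X)"
  have "((\<lambda>t. - (?I t ** X ** matrix_inv P)) \<longlongrightarrow> - (?I 0 ** X ** matrix_inv P)) (at 0)"
    using isCont_matrix_inv_line(1)[OF assms, of X] unfolding isCont_def
    by (intro tendsto_minus B.tendsto tendsto_const)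
  moreover have "eventually (\<lambda>t. (1/t) *\<^sub>R (?I t - ?I 0) = - (?I t ** X ** matrix_inv P)) (at 0)"
    using isCont_matrix_inv_line(2)[OF assms, of X] eventually_neq_at_within[of 0 0 UNIV]
  proof eventually_elim
    case (elim t)
    let ?A = "P + t *\<^sub>R X"
    have A: "?I t ** ?A = mat 1"
      using elim by (intro matrix_inv_left_right) (simp add: invertible_det_nz)
    have B: "P ** matrix_inv P = mat 1"
      by (rule matrix_inv_left_right[OF assms])
    have "?I t - matrix_inv P = ?I t ** (P ** matrix_inv P) - (?I t ** ?A) ** matrix_inv P"
      by (simp only: A B matrix_mul_lid matrix_mul_rid)
    also have "\<dots> = ?I t ** (P - ?A) ** matrix_inv P"
      by (simp only: matrix_mul_assoc B.diff_left B.diff_right)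
    also have "\<dots> = - (t *\<^sub>R (?I t ** X ** matrix_inv P))"
    proof -
      have "P - ?A = - (t *\<^sub>R X)" by simp
      then show ?thesis by (simp only: B.scaleR_left B.scaleR_right B.minus_left B.minus_right)
    qed
    finally show ?case using elim by simp
  qed
  ultimately have "((\<lambda>t. (1/t) *\<^sub>R (?I t - ?I 0)) \<longlongrightarrow> - (?I 0 ** X ** matrix_inv P)) (at 0)"
    by (subst tendsto_cong)
  then have "((\<lambda>t. norm ((1/t) *\<^sub>R (?I t - ?I 0) - - (?I 0 ** X ** matrix_inv P))) \<longlongrightarrow> 0) (at 0)"
    by (intro tendsto_norm_zero LIM_zero)
  moreover have "eventually (\<lambda>t. norm ((1/t) *\<^sub>R (?I t - ?I 0) - - (?I 0 ** X ** matrix_inv P))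
      = norm ((1 / norm (t - 0)) *\<^sub>R
          (?I t - (?I 0 + (t - 0) *\<^sub>R - (?I 0 ** X ** matrix_inv P))))) (at (0::real))"
    using eventually_neq_at_within[of 0 0 UNIV]
  proof eventually_elim
    case (elim t)
    let ?D = "- (?I 0 ** X ** matrix_inv P)"
    have "(1/t) *\<^sub>R (?I t - ?I 0) - ?D = (1/t) *\<^sub>R (?I t - (?I 0 + (t - 0) *\<^sub>R ?D))"
      using elim by (simp add: scaleR_right_diff_distrib scaleR_right_distrib)
    then show ?case by (simp only: norm_scaleR) simp
  qed
  ultimately have "((\<lambda>t. (1 / norm (t - 0)) *\<^sub>R
          (?I t - (?I 0 + (t - 0) *\<^sub>R - (?I 0 ** X ** matrix_inv P)))) \<longlongrightarrow> 0) (at (0::real))"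
    by (subst tendsto_norm_zero_iff[symmetric], subst tendsto_cong[symmetric]) assumption
  then show ?thesis
    unfolding has_vector_derivative_def has_derivative_at2
    by (simp add: bounded_linear_scaleR_left bounded_linear_minus)
qed

lemma nabla_g_torsion_free:
  "nabla_g X Y P - nabla_g Y X P = nabla_E X Y P - nabla_E Y X P"
  by (simp add: nabla_g_def add.commute)

lemma nabla_g_metric:
  fixes P :: "real^'m::finite^'m"
  assumes "P \<in> SPD"
    and Y: "(\<lambda>t. Y (P + t *\<^sub>R X P)) differentiable (at 0)"
    and Z: "(\<lambda>t. Z (P + t *\<^sub>R X P)) differentiable (at 0)"
  shows "((\<lambda>t. affine_invariant_metric (P + t *\<^sub>R X P) (Y (P + t *\<^sub>R X P)) (Z (P + t *\<^sub>R X P)))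
     has_real_derivative
       affine_invariant_metric P (nabla_g X Y P) (Z P)
     + affine_invariant_metric P (Y P) (nabla_g X Z P)) (at 0)"
proof -
  interpret B: bounded_bilinear "(**) :: real^'m^'m \<Rightarrow> real^'m^'m \<Rightarrow> real^'m^'m"
    by (rule bounded_bilinear_matrix_mult)
  let ?J = "matrix_inv P" and ?X = "X P" and ?Y = "Y P" and ?Z = "Z P"
  let ?DY = "nabla_E X Y P" and ?DZ = "nabla_E X Z P"
  note DY = Y[unfolded vector_derivative_works, folded nabla_E_def]
  note DZ = Z[unfolded vector_derivative_works, folded nabla_E_def]
  note DI = has_vector_derivative_matrix_inv_line[OF SPD_invertible[OF assms(1)], of ?X]
  have lin: "bounded_linear (trace :: real^'m^'m \<Rightarrow> real)"
    unfolding linear_conv_bounded_linear[symmetric]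
    by (auto intro!: linearI simp: trace_def sum.distrib sum_distrib_left)
  have cyc: "trace (?J ** ?Y ** ?J ** ?Z ** ?J ** ?X) = trace (?J ** ?X ** ?J ** ?Y ** ?J ** ?Z)"
    using trace_mul_sym[of "?J ** ?Y ** ?J ** ?Z" "?J ** ?X"] by (simp add: matrix_mul_assoc)
  note D = bounded_linear.has_vector_derivative[OF lin
      B.has_vector_derivative[OF B.has_vector_derivative[OF B.has_vector_derivative[OF DI DY] DI] DZ]]
  note tr = linear_add[OF bounded_linear.linear[OF lin]] linear_diff[OF bounded_linear.linear[OF lin]]
      linear_neg[OF bounded_linear.linear[OF lin]] linear_cmul[OF bounded_linear.linear[OF lin]]
  note mm = matrix_mul_assoc B.add_left B.add_right B.diff_left B.diff_right B.minus_left B.minus_right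
      B.scaleR_left B.scaleR_right
  show ?thesis
    unfolding has_real_derivative_iff_has_vector_derivative affine_invariant_metric_def
    apply (rule has_vector_derivative_eq_rhs[OF D])
    apply (simp add: nabla_g_def mm tr)
    using cyc apply (simp add: field_simps)
    done
qed

end

theory Submission
  imports Defs
begin

text \<open>
  A symmetric matrix \<open>Q\<close> and a positive definite \<open>P\<close> have the simultaneous form
  \<open>P = Y diag(a) Y\<^sup>T\<close>, \<open>Q = Y diag(m) Y\<^sup>T\<close> (\<open>simultaneous_diagonalisation\<close>, resting on the spectral theorem). The
  geodesic equation of \<open>\<nabla>\<^sup>\<alpha>\<close>, which reads \<open>\<gamma>'' = (1 - \<alpha>) \<gamma>' \<gamma>\<^sup>-\<^sup>1 \<gamma>'\<close>, is invariant under congruence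
  and splits into scalar equations in such a basis. The midpoint of positive definite \<open>P\<close> and \<open>Q\<close> is therefore
  \<open>Y diag(p) Y\<^sup>T\<close>, where \<open>p\<close> is the entrywise power mean of \<open>a\<close> and \<open>m\<close> with exponent \<open>\<alpha>\<close>
  (\<open>midpoint_map_nabla_alpha_cdiag\<close>).

  The midpoint map is a definite description, so every geodesic between the two points has to be
  controlled. Given any geodesic, diagonalise its initial velocity together with its initial point. A combination
  of \<open>\<gamma>\<close> and \<open>\<gamma>'\<close> applied to an eigenvector satisfies a homogeneous linear differential equation with
  initial value 0, so it vanishes, and the curve is diagonal at all times with explicit entries
  (\<open>geodesic_eigenvector\<close>, \<open>affine_geodesic_imp_profile\<close>). The basis found in this way depends on the
  geodesic. That its midpoint nevertheless does not is due to the homogeneity of the power mean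
  (\<open>cdiag_homogeneous_fun_unique\<close>); the same lemma makes the functional calculus well defined and yields
  \<open>P\<^sup>1\<^sup>/\<^sup>2 f(S) P\<^sup>1\<^sup>/\<^sup>2 = Y diag(a f(m / a)) Y\<^sup>T\<close> (\<open>spectral_mean_cdiag\<close>).

  All iterates are consequently diagonal in one basis, and the claims are about pairs of positive numbers. Write
  such a pair as \<open>g e\<^sup>-\<^sup>x\<close>, \<open>g e\<^sup>x\<close>. The power means with exponents \<open>\<alpha>\<close> and \<open>- \<alpha>\<close> keep \<open>g\<close> and replace \<open>x\<close> by
  \<open>- ln (cosh (\<alpha> x)) / \<alpha>\<close> (\<open>pow_mean_exp\<close>), or by 0 if \<open>\<alpha> = 0\<close>. Conservation of \<open>g\<close> is the invariance of the
  geometric mean; \<open>\<delta>\<close> is the maximum of \<open>\<bar>x\<bar>\<close> over the diagonal; \<open>ln (cosh y) \<le> y\<^sup>2 / 2\<close> gives the quadratic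
  estimate and \<open>ln (cosh y) < \<bar>y\<bar>\<close> for nonzero \<open>y\<close> the strict decrease, which forces \<open>x\<close> to tend to 0.
\<close>

section \<open>The spectral theorem for real symmetric matrices\<close>

lemma symmetric_inner_commute:
  fixes A :: "real^'m::finite^'m"
  assumes "transpose A = A"
  shows "(A *v x) \<bullet> y = x \<bullet> (A *v y)"
  by (metis assms dot_lmul_matrix vector_transpose_matrix)

text \<open>If \<open>c\<close> were nonzero, the linear term would dominate for small \<open>t\<close> and make the polynomial negative
  on one side of 0. This is the first-order condition at a minimum, without derivatives.\<close>

lemma linear_coefficient_eq_0:
  fixes c k :: real
  assumes "\<And>t. 0 \<le> 2 * t * c + t\<^sup>2 * k"
  shows "c = 0"
proof (rule ccontr)
  assume "c \<noteq> 0"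
  define q where "q = \<bar>k\<bar> + 1"
  have q: "q > 0" "k < 2 * q" by (auto simp: q_def)
  have "2 * (- c / q) * c + (- c / q)\<^sup>2 * k = c\<^sup>2 / q\<^sup>2 * (k - 2 * q)"
    using q by (simp add: field_simps power2_eq_square)
  also have "\<dots> < 0"
    using q \<open>c \<noteq> 0\<close> by (intro mult_pos_neg) auto
  finally show False using assms[of "- c / q"] by simp
qed

text \<open>The Rayleigh quotient attains a maximum \<open>l\<close> on the unit sphere of \<open>V\<close>.
  The form of \<open>l I - A\<close> is then nonnegative on \<open>V\<close> and vanishes at the maximiser \<open>x\<close>, hence \<open>l x - A x\<close> is
  orthogonal to \<open>V\<close>; as it also lies in \<open>V\<close>, it is 0.\<close>

lemma symmetric_eigenvector_in_invariant_subspace: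
  fixes A :: "real^'m::finite^'m"
  assumes sym: "transpose A = A" and sub: "subspace V"
    and inv: "\<And>x. x \<in> V \<Longrightarrow> A *v x \<in> V" and ne: "z \<in> V" "z \<noteq> 0"
  obtains x l where "x \<in> V" "norm x = 1" "A *v x = l *\<^sub>R x"
proof -
  define K where "K = V \<inter> sphere 0 1"
  have "compact K"
    unfolding K_def by (intro closed_Int_compact closed_subspace sub compact_sphere)
  moreover have "(1 / norm z) *\<^sub>R z \<in> K"
    using ne sub by (auto simp: K_def subspace_scale)
  moreover have "continuous_on K (\<lambda>x. x \<bullet> (A *v x))"
    by (intro continuous_intros linear_continuous_on) simp
  ultimately obtain x where x: "x \<in> K" and max: "\<And>y. y \<in> K \<Longrightarrow> y \<bullet> (A *v y) \<le> x \<bullet> (A *v x)"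
    using continuous_attains_sup[of K "\<lambda>x. x \<bullet> (A *v x)"] by auto
  define l where "l = x \<bullet> (A *v x)"
  have xV: "x \<in> V" and nx: "norm x = 1" using x by (auto simp: K_def)
  have psd: "0 \<le> l * (y \<bullet> y) - y \<bullet> (A *v y)" if y: "y \<in> V" for y
  proof (cases "y = 0")
    case False
    have "(1 / norm y) *\<^sub>R y \<in> K" using False y sub by (auto simp: K_def subspace_scale)
    from max[OF this] have "(y \<bullet> (A *v y)) / (norm y)\<^sup>2 \<le> l"
      by (simp add: l_def matrix_vector_mult_scaleR power2_eq_square)
    then show ?thesis using False by (simp add: field_simps power2_norm_eq_inner)
  qed simp
  have "y \<bullet> (l *\<^sub>R x - A *v x) = 0" if y: "y \<in> V" for y
  proof (rule linear_coefficient_eq_0)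
    fix t :: real
    have "0 \<le> l * ((x + t *\<^sub>R y) \<bullet> (x + t *\<^sub>R y)) - (x + t *\<^sub>R y) \<bullet> (A *v (x + t *\<^sub>R y))"
      by (intro psd subspace_add subspace_scale sub xV y)
    also have "\<dots> = 2 * t * (y \<bullet> (l *\<^sub>R x - A *v x)) + t\<^sup>2 * (l * (y \<bullet> y) - y \<bullet> (A *v y))"
      using nx symmetric_inner_commute[OF sym, of x y]
      by (simp add: l_def matrix_vector_mult_scaleR matrix_vector_right_distrib inner_add_left
          inner_add_right inner_diff_right algebra_simps power2_eq_square inner_commute
          norm_eq_1)
    finally show "0 \<le> 2 * t * (y \<bullet> (l *\<^sub>R x - A *v x)) + t\<^sup>2 * (l * (y \<bullet> y) - y \<bullet> (A *v y))" .
  qed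
  moreover have "l *\<^sub>R x - A *v x \<in> V"
    by (intro subspace_diff subspace_scale sub inv xV)
  ultimately have "l *\<^sub>R x - A *v x = 0" by (metis inner_eq_zero_iff)
  then show thesis using that[OF xV nx, of l] by simp
qed

text \<open>Choose an orthonormal set of eigenvectors of maximal size. Its orthogonal
  complement is invariant, so if that were nonzero it would contain one more eigenvector.\<close>

lemma symmetric_orthonormal_eigenbasis:
  fixes A :: "real^'m::finite^'m"
  assumes sym: "transpose A = A"
  obtains B where "pairwise orthogonal B" "\<And>x. x \<in> B \<Longrightarrow> norm x = 1"
    "\<And>x. x \<in> B \<Longrightarrow> \<exists>l. A *v x = l *\<^sub>R x" "finite B" "card B = CARD('m)"
proof -
  define good where "good B \<longleftrightarrow> pairwise orthogonal B \<and>
    (\<forall>x\<in>B. norm x = 1 \<and> (\<exists>l. A *v x = l *\<^sub>R x))" for B :: "(real^'m) set"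
  have indep: "independent B" if "good B" for B
    using that by (intro pairwise_orthogonal_independent) (auto simp: good_def)
  have bound: "card B \<le> CARD('m)" if "good B" for B
    using independent_card_le[OF indep[OF that]] by simp
  have "good {}" by (simp add: good_def)
  then obtain B where B: "good B" and max: "\<And>C. good C \<Longrightarrow> card C \<le> card B"
    using ex_has_greatest_nat[of good "{}" card "CARD('m) + 1"] bound by (metis less_Suc_eq_le Suc_eq_plus1)
  have fin: "finite B" using indep[OF B] independent_imp_finite by blast
  have "card B = CARD('m)"
  proof (rule ccontr)
    assume "card B \<noteq> CARD('m)"
    then have "dim B < DIM(real^'m)"
      using bound[OF B] dim_eq_card_independent[OF indep[OF B]] by simp
    then obtain z where z: "z \<noteq> 0" "\<And>y. y \<in> span B \<Longrightarrow> orthogonal z y"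
      using orthogonal_to_subspace_exists by blast
    define V where "V = {x. \<forall>b\<in>B. x \<bullet> b = 0}"
    have sub: "subspace V" by (auto simp: V_def subspace_def inner_add_left)
    have inv: "A *v x \<in> V" if "x \<in> V" for x
      unfolding V_def
    proof (intro CollectI ballI)
      fix b assume b: "b \<in> B"
      then obtain l where "A *v b = l *\<^sub>R b" using B by (auto simp: good_def)
      then show "(A *v x) \<bullet> b = 0"
        using that b by (simp add: symmetric_inner_commute[OF sym] V_def)
    qed
    have "z \<in> V" using z by (auto simp: V_def orthogonal_def span_base)
    then obtain x l where x: "x \<in> V" "norm x = 1" "A *v x = l *\<^sub>R x"
      using symmetric_eigenvector_in_invariant_subspace[OF sym sub inv _ z(1)] by blast
    have "x \<notin> B" using x by (auto simp: V_def)
    moreover have "good (insert x B)"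
      using B x by (auto simp: good_def pairwise_insert orthogonal_def V_def inner_commute)
    ultimately show False using max[of "insert x B"] fin by simp
  qed
  then show thesis using that[of B] B fin by (auto simp: good_def)
qed

section \<open>Matrices congruent to diagonal ones\<close>

text \<open>The factor \<open>Y\<close> is not required to be orthogonal: two symmetric matrices, one of them positive
  definite, can be written in this form with the same \<open>Y\<close>, and the connections, the means and the geometric mean
  are all compatible with congruence.\<close>

definition cdiag :: "real^'m::finite^'m \<Rightarrow> ('m \<Rightarrow> real) \<Rightarrow> real^'m^'m" where
  "cdiag Y d = Y ** diag_matrix (\<chi> i. d i) ** transpose Y"

lemma matrix_mult_diag_component:
  "(A ** diag_matrix d) $ i $ j = A $ i $ j * d $ j"
  "(diag_matrix d ** A) $ i $ j = d $ i * A $ i $ j" for A :: "real^'m::finite^'m"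
  by (simp_all add: matrix_matrix_mult_def diag_matrix_def if_distrib[of "\<lambda>x. _ * x"]
      if_distrib[of "\<lambda>x. x * _"] cong: if_cong)

theorem symmetric_diagonalisation:
  fixes A :: "real^'m::finite^'m"
  assumes sym: "transpose A = A"
  obtains U d where "orthogonal_matrix U" "A = cdiag U d"
proof -
  obtain B where B: "pairwise orthogonal B" "\<And>x. x \<in> B \<Longrightarrow> norm x = 1"
    "\<And>x. x \<in> B \<Longrightarrow> \<exists>l. A *v x = l *\<^sub>R x" "finite B" "card B = CARD('m)"
    using symmetric_orthonormal_eigenbasis[OF sym] by metis
  then obtain f where f: "bij_betw f (UNIV::'m set) B"
    by (metis finite_class.finite_UNIV finite_same_card_bij)
  then have fB: "f i \<in> B" for i by (auto simp: bij_betw_def)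
  have "\<forall>i. \<exists>l. A *v f i = l *\<^sub>R f i" using B(3) fB by blast
  then obtain d where d: "\<And>i. A *v f i = d i *\<^sub>R f i" by (auto simp: choice_iff)
  define U where "U = (\<chi> i j. f j $ i)"
  have "orthogonal (f i) (f j)" if "i \<noteq> j" for i j
    using that B(1) f fB by (meson UNIV_I bij_betw_imp_inj_on inj_onD pairwiseD)
  then have U: "orthogonal_matrix U"
    using B(2)[OF fB] by (simp add: U_def orthogonal_matrix_orthonormal_columns column_def)
  have "A ** U = U ** diag_matrix (\<chi> i. d i)"
  proof -
    have "(A ** U) $ i $ j = (A *v f j) $ i" for i j
      by (simp add: matrix_matrix_mult_def matrix_vector_mult_def U_def)
    then show ?thesis
      by (simp add: vec_eq_iff matrix_mult_diag_component d) (simp add: U_def)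
  qed
  then have "A ** (U ** transpose U) = cdiag U d"
    by (simp only: cdiag_def matrix_mul_assoc)
  then have "A = cdiag U d" using U by (simp add: orthogonal_matrix_def)
  with U show thesis by (rule that)
qed

lemma cdiag_congruence: "R ** cdiag Y d ** transpose R = cdiag (R ** Y) d"
  by (simp add: cdiag_def matrix_transpose_mul matrix_mul_assoc)

lemma transpose_diag_matrix [simp]: "transpose (diag_matrix d) = diag_matrix d"
  by (auto simp: transpose_def diag_matrix_def vec_eq_iff)

lemma transpose_cdiag [simp]: "transpose (cdiag Y d) = cdiag Y d"
  by (simp add: cdiag_def matrix_transpose_mul matrix_mul_assoc)

lemma diag_matrix_mult:
  "diag_matrix (\<chi> i. d i) ** diag_matrix (\<chi> i. e i) = diag_matrix (\<chi> i. d i * e i)"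
  for d e :: "'m::finite \<Rightarrow> real"
  unfolding vec_eq_iff matrix_mult_diag_component by (simp add: diag_matrix_def)

lemma diag_matrix_1: "diag_matrix (\<chi> i. 1) = (mat 1 :: real^'m::finite^'m)"
  by (auto simp: vec_eq_iff diag_matrix_def mat_def)

lemma matrix_inv_unique:
  fixes A B :: "real^'m::finite^'m"
  assumes "A ** B = mat 1"
  shows "matrix_inv A = B"
proof -
  have "invertible A" using assms invertible_right_inverse by blast
  then have "matrix_inv A ** (A ** B) = B"
    by (simp add: matrix_mul_assoc matrix_inv_left_right)
  then show ?thesis by (simp add: assms)
qed

lemma cdiag_mult_dual:
  fixes Y Z :: "real^'m::finite^'m"
  assumes "transpose Y ** Z = mat 1"
  shows "cdiag Y d ** cdiag Z e = Y ** diag_matrix (\<chi> i. d i * e i) ** transpose Z"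
proof -
  have "cdiag Y d ** cdiag Z e
      = Y ** diag_matrix (\<chi> i. d i) ** (transpose Y ** Z) ** diag_matrix (\<chi> i. e i) ** transpose Z"
    by (simp add: cdiag_def matrix_mul_assoc)
  also have "\<dots> = Y ** (diag_matrix (\<chi> i. d i) ** diag_matrix (\<chi> i. e i)) ** transpose Z"
    by (simp add: assms matrix_mul_assoc)
  finally show ?thesis by (simp add: diag_matrix_mult)
qed

lemma cdiag_mult_orthogonal:
  "orthogonal_matrix U \<Longrightarrow> cdiag U d ** cdiag U e = cdiag U (\<lambda>i. d i * e i)"
  by (subst cdiag_mult_dual) (simp_all add: orthogonal_matrix_def cdiag_def)

lemma cdiag_orthogonal_1: "orthogonal_matrix U \<Longrightarrow> cdiag U (\<lambda>_. 1) = mat 1"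
  by (simp add: cdiag_def diag_matrix_1 orthogonal_matrix_def)

lemma invertible_orthogonal: "orthogonal_matrix U \<Longrightarrow> invertible U"
  by (auto simp: invertible_def orthogonal_matrix_def)

text \<open>The columns of \<open>transpose (matrix_inv Y)\<close> form the basis dual to the columns of \<open>Y\<close>,
  so products of a matrix in one basis with a matrix in the other collapse to diagonal ones.\<close>

lemma inverse_transpose_dual:
  fixes Y :: "real^'m::finite^'m"
  assumes "invertible Y"
  shows "transpose Y ** transpose (matrix_inv Y) = mat 1"
  using matrix_inv_left_right(2)[OF assms]
  by (metis matrix_transpose_mul transpose_mat)

lemma matrix_inv_cdiag:
  fixes Y :: "real^'m::finite^'m"
  assumes Y: "invertible Y" and d: "\<And>i. d i \<noteq> 0"
  shows "matrix_inv (cdiag Y d) = cdiag (transpose (matrix_inv Y)) (\<lambda>i. 1 / d i)"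
  by (rule matrix_inv_unique)
     (simp add: cdiag_mult_dual inverse_transpose_dual Y d diag_matrix_1 matrix_inv_left_right)

lemma cdiag_quadratic_form:
  fixes Y :: "real^'m::finite^'m"
  shows "x \<bullet> (cdiag Y d *v x) = (\<Sum>i\<in>UNIV. d i * ((transpose Y *v x) $ i)\<^sup>2)"
proof -
  let ?z = "transpose Y *v x"
  have "x \<bullet> (cdiag Y d *v x) = ?z \<bullet> (diag_matrix (\<chi> i. d i) *v ?z)"
    by (simp only: cdiag_def transpose_matrix_vector dot_lmul_matrix matrix_vector_mul_assoc[symmetric])
  also have "(diag_matrix (\<chi> i. d i) *v ?z) $ i = d i * ?z $ i" for i
    by (simp add: matrix_vector_mult_def diag_matrix_def if_distrib[of "\<lambda>x. x * _"]
        cong: if_cong)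
  then have "?z \<bullet> (diag_matrix (\<chi> i. d i) *v ?z) = (\<Sum>i\<in>UNIV. d i * (?z $ i)\<^sup>2)"
    by (simp add: inner_vec_def power2_eq_square mult_ac)
  finally show ?thesis .
qed

lemma invertible_mult_eq_0_iff:
  fixes A :: "real^'m::finite^'m"
  assumes "invertible A"
  shows "A *v x = 0 \<longleftrightarrow> x = 0"
  by (metis assms matrix_inv_left_right(2) matrix_vector_mul_assoc matrix_vector_mul_lid
      matrix_vector_mult_0_right)

lemma cdiag_SPD:
  fixes Y :: "real^'m::finite^'m"
  assumes Y: "invertible Y" and d: "\<And>i. 0 < d i"
  shows "cdiag Y d \<in> SPD"
  unfolding SPD_def
proof (intro CollectI conjI allI impI)
  fix x :: "real^'m" assume "x \<noteq> 0"
  then have "transpose Y *v x \<noteq> 0"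
    using invertible_mult_eq_0_iff transpose_invertible[OF Y] by blast
  then obtain i where i: "(transpose Y *v x) $ i \<noteq> 0" by (auto simp: vec_eq_iff)
  have "0 < d i * ((transpose Y *v x) $ i)\<^sup>2" using d[of i] i by simp
  also have "\<dots> \<le> (\<Sum>i\<in>UNIV. d i * ((transpose Y *v x) $ i)\<^sup>2)"
    by (intro member_le_sum) (simp_all add: d[THEN less_imp_le])
  finally show "0 < x \<bullet> (cdiag Y d *v x)" by (simp only: cdiag_quadratic_form)
qed (rule transpose_cdiag)

text \<open>The \<open>i\<close>-th diagonal entry is the value of the quadratic form at the \<open>i\<close>-th vector of the
  basis dual to the columns of \<open>Y\<close>.\<close>

lemma SPD_cdiag_pos:
  fixes Y :: "real^'m::finite^'m"
  assumes Y: "invertible Y" and S: "cdiag Y d \<in> SPD"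
  shows "0 < d i"
proof -
  let ?x = "transpose (matrix_inv Y) *v axis i 1"
  have eq: "transpose Y *v ?x = axis i 1"
    by (simp only: matrix_vector_mul_assoc inverse_transpose_dual[OF Y] matrix_vector_mul_lid)
  have "?x \<noteq> 0"
  proof
    assume "?x = 0"
    then have "axis i 1 = (0 :: real^'m)" using eq by (simp only: matrix_vector_mult_0_right)
    then show False by (simp add: axis_eq_0_iff)
  qed
  then have "0 < ?x \<bullet> (cdiag Y d *v ?x)" using S unfolding SPD_def by blast
  also have "\<dots> = (\<Sum>j\<in>UNIV. d j * ((axis i 1 :: real^'m) $ j)\<^sup>2)"
    by (simp only: cdiag_quadratic_form eq)
  also have "\<dots> = (\<Sum>j\<in>UNIV. if j = i then d j else 0)"
    by (rule sum.cong) (simp_all add: axis_def)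
  finally show ?thesis by simp
qed

lemma SPD_diagonalisation:
  fixes P :: "real^'m::finite^'m"
  assumes "P \<in> SPD"
  obtains U d where "orthogonal_matrix U" "P = cdiag U d" "\<And>i. 0 < d i"
proof -
  have "transpose P = P" using assms by (simp add: SPD_def)
  then obtain U d where U: "orthogonal_matrix U" "P = cdiag U d"
    by (rule symmetric_diagonalisation)
  have "0 < d i" for i
    using SPD_cdiag_pos[OF invertible_orthogonal[OF U(1)]] assms unfolding U(2) by blast
  then show thesis using that[OF U] by blast
qed

section \<open>Simultaneous diagonalisation and functional calculus\<close>

text \<open>With \<open>W = Z\<^sup>-\<^sup>1 Y\<close> and \<open>V\<close> the inverse transpose of \<open>W\<close>, the hypotheses on the pairs read
  \<open>W\<^sub>i\<^sub>j a\<^sub>j = b\<^sub>i V\<^sub>i\<^sub>j\<close> and \<open>W\<^sub>i\<^sub>j m\<^sub>j = n\<^sub>i V\<^sub>i\<^sub>j\<close>. Wherever \<open>W\<^sub>i\<^sub>j\<close> is nonzero,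
  \<open>(a\<^sub>j, m\<^sub>j)\<close> is thus a positive multiple of \<open>(b\<^sub>i, n\<^sub>i)\<close>, and homogeneity gives the same relation for
  \<open>F\<close>. The independence of the spectral calculus of the eigenbasis (\<open>a = b = 1\<close>) and the uniqueness of the midpoints
  of geodesics are both instances.\<close>

lemma cdiag_homogeneous_fun_unique:
  fixes Y Z :: "real^'m::finite^'m"
  assumes inv: "invertible Y" "invertible Z" and pos: "\<And>i. 0 < a i" "\<And>i. 0 < b i"
    and 1: "cdiag Y a = cdiag Z b" and 2: "cdiag Y m = cdiag Z n"
    and hom: "\<And>c i. 0 < c \<Longrightarrow> F (c * b i) (c * n i) = c * F (b i) (n i)"
  shows "cdiag Y (\<lambda>i. F (a i) (m i)) = cdiag Z (\<lambda>i. F (b i) (n i))"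
proof -
  define W where "W = matrix_inv Z ** Y"
  define V where "V = transpose Z ** transpose (matrix_inv Y)"
  \<comment> \<open>Multiply by \<open>Z\<^sup>-\<^sup>1\<close> on the left and by the inverse transpose of \<open>Y\<close> on the right.\<close>
  have WV: "W ** diag_matrix (\<chi> i. d i) = diag_matrix (\<chi> i. e i) ** V
      \<longleftrightarrow> cdiag Y d = cdiag Z e" for d e
  proof -
    have Y: "transpose Y ** transpose (matrix_inv Y) = mat 1"
      "transpose (matrix_inv Y) ** transpose Y = mat 1"
      using inverse_transpose_dual[OF inv(1)] matrix_left_right_inverse by blast+
    note Z = matrix_inv_left_right[OF inv(2)]
    have "W ** diag_matrix (\<chi> i. d i) = matrix_inv Z ** cdiag Y d ** transpose (matrix_inv Y)"
      by (simp add: W_def cdiag_def matrix_mul_assoc[symmetric] Y)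
    moreover have "diag_matrix (\<chi> i. e i) ** V = matrix_inv Z ** cdiag Z e ** transpose (matrix_inv Y)"
      by (simp add: V_def cdiag_def matrix_mul_assoc Z)
    moreover have "Z ** (matrix_inv Z ** X ** transpose (matrix_inv Y)) ** transpose Y = X" for X
    proof -
      have "Z ** (matrix_inv Z ** X ** transpose (matrix_inv Y)) ** transpose Y
        = (Z ** matrix_inv Z) ** X ** (transpose (matrix_inv Y) ** transpose Y)"
        by (simp add: matrix_mul_assoc)
      then show ?thesis by (simp add: Y Z)
    qed
    ultimately show ?thesis by metis
  qed
  have a: "W $ i $ j * a j = b i * V $ i $ j" and m: "W $ i $ j * m j = n i * V $ i $ j" for i j
    using 1 2 unfolding WV[symmetric] by (simp_all add: vec_eq_iff matrix_mult_diag_component)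
  have "W $ i $ j * F (a j) (m j) = F (b i) (n i) * V $ i $ j" for i j
  proof (cases "W $ i $ j = 0")
    case True
    then show ?thesis using a[of i j] pos(2)[of i] by simp
  next
    case False
    define c where "c = V $ i $ j / W $ i $ j"
    have c: "a j = c * b i" "m j = c * n i" "V $ i $ j = W $ i $ j * c"
      using a[of i j] m[of i j] False by (simp_all add: c_def field_simps)
    have "0 < c" using c(1) pos by (metis zero_less_mult_pos2)
    then show ?thesis using c hom by simp
  qed
  then show ?thesis
    unfolding WV[symmetric] by (simp add: vec_eq_iff matrix_mult_diag_component mult.commute)
qed

lemma spectral_fun_cdiag:
  fixes U :: "real^'m::finite^'m"
  assumes U: "orthogonal_matrix U"
  shows "spectral_fun f (cdiag U d) = cdiag U (\<lambda>i. f (d i))"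
  unfolding spectral_fun_def
proof (rule the_equality)
  show "\<exists>V e. orthogonal_matrix V \<and> cdiag U d = V ** diag_matrix e ** transpose V
      \<and> cdiag U (\<lambda>i. f (d i)) = V ** diag_matrix (\<chi> i. f (e $ i)) ** transpose V"
    by (rule exI[of _ U], rule exI[of _ "\<chi> i. d i"]) (simp add: U cdiag_def)
next
  fix B assume "\<exists>V e. orthogonal_matrix V \<and> cdiag U d = V ** diag_matrix e ** transpose V
      \<and> B = V ** diag_matrix (\<chi> i. f (e $ i)) ** transpose V"
  then obtain V e where V: "orthogonal_matrix V" and d: "cdiag U d = cdiag V (\<lambda>i. e $ i)"
    and B: "B = cdiag V (\<lambda>i. f (e $ i))"
    by (auto simp: cdiag_def)
  have "cdiag U (\<lambda>i. 1 * f (d i / 1)) = cdiag V (\<lambda>i. 1 * f (e $ i / 1))"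
    by (rule cdiag_homogeneous_fun_unique[where F = "\<lambda>x y. x * f (y / x)"])
       (simp_all add: U V d invertible_orthogonal cdiag_orthogonal_1)
  then show "B = cdiag U (\<lambda>i. f (d i))" by (simp add: B)
qed

lemma spd_powr_cdiag:
  "orthogonal_matrix U \<Longrightarrow> spd_powr (cdiag U d) r = cdiag U (\<lambda>i. d i powr r)"
  by (simp add: spd_powr_def spectral_fun_cdiag)

lemma SPD_square_root:
  fixes P :: "real^'m::finite^'m"
  assumes P: "P \<in> SPD"
  shows "spd_powr P (1/2) ** spd_powr P (1/2) = P"
    and "spd_powr P (- (1/2)) ** spd_powr P (1/2) = mat 1"
    and "spd_powr P (1/2) ** spd_powr P (- (1/2)) = mat 1"
    and "transpose (spd_powr P r) = spd_powr P r"
proof -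
  obtain U d where U: "orthogonal_matrix U" and P: "P = cdiag U d" and d: "\<And>i. 0 < d i"
    using SPD_diagonalisation[OF P] by blast
  have d': "d i \<noteq> 0" "0 \<le> d i" for i using d[of i] by auto
  show "spd_powr P (1/2) ** spd_powr P (1/2) = P"
    "spd_powr P (- (1/2)) ** spd_powr P (1/2) = mat 1"
    "spd_powr P (1/2) ** spd_powr P (- (1/2)) = mat 1"
    by (simp_all add: P U spd_powr_cdiag cdiag_mult_orthogonal powr_add[symmetric] d' 
        cdiag_orthogonal_1)
  show "transpose (spd_powr P r) = spd_powr P r" by (simp add: P U spd_powr_cdiag)
qed

text \<open>The expression \<open>P\<^sup>1\<^sup>/\<^sup>2 f(S) P\<^sup>1\<^sup>/\<^sup>2\<close> with \<open>S = P\<^sup>-\<^sup>1\<^sup>/\<^sup>2 Q P\<^sup>-\<^sup>1\<^sup>/\<^sup>2\<close>, shared by the geometric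
  mean and the closed formulas for the iterates.\<close>

definition spectral_mean :: "(real \<Rightarrow> real) \<Rightarrow> real^'m::finite^'m \<Rightarrow> real^'m^'m \<Rightarrow> real^'m^'m" where
  "spectral_mean f P Q = spd_powr P (1/2)
     ** spectral_fun f (spd_powr P (- (1/2)) ** Q ** spd_powr P (- (1/2)))
     ** spd_powr P (1/2)"

text \<open>Diagonalise \<open>S = P\<^sup>-\<^sup>1\<^sup>/\<^sup>2 Q P\<^sup>-\<^sup>1\<^sup>/\<^sup>2\<close> by an orthogonal \<open>U\<close> and put
  \<open>Y = P\<^sup>1\<^sup>/\<^sup>2 U\<close>; then the square roots are absorbed into \<open>Y\<close>.\<close>

lemma simultaneous_diagonalisation:
  fixes P Q :: "real^'m::finite^'m"
  assumes P: "P \<in> SPD" and Q: "transpose Q = Q"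
  obtains Y l where "invertible Y" "P = cdiag Y (\<lambda>_. 1)" "Q = cdiag Y l"
    "\<And>f. spectral_mean f P Q = cdiag Y (\<lambda>i. f (l i))" 
proof -
  let ?R = "spd_powr P (1/2)" and ?R' = "spd_powr P (- (1/2))"
  note R = SPD_square_root[OF P]
  define S where "S = ?R' ** Q ** ?R'"
  have "transpose S = S"
    by (simp add: S_def matrix_transpose_mul R Q matrix_mul_assoc)
  then obtain U l where U: "orthogonal_matrix U" and S: "S = cdiag U l"
    using symmetric_diagonalisation by blast
  have inv: "invertible ?R" "invertible ?R'" using R by (auto simp: invertible_def)
  have RR: "?R ** cdiag U d ** ?R = cdiag (?R ** U) d" for d
    using cdiag_congruence[of ?R U d] R by simp
  have P1: "P = cdiag (?R ** U) (\<lambda>_. 1)"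
    using RR[of "\<lambda>_. 1"] by (simp add: U cdiag_orthogonal_1 R)
  have "?R ** S ** ?R = (?R ** ?R') ** Q ** (?R' ** ?R)"
    by (simp add: S_def matrix_mul_assoc)
  then have Q1: "Q = cdiag (?R ** U) l" using RR[of l] R by (simp add: S)
  have "spectral_mean f P Q = cdiag (?R ** U) (\<lambda>i. f (l i))" for f
    using RR by (simp add: spectral_mean_def S_def[symmetric] S spectral_fun_cdiag U)
  then show thesis
    using that[of "?R ** U" l] P1 Q1 inv invertible_mult invertible_orthogonal[OF U] by blast
qed

text \<open>The homogeneous function to use is the perspective \<open>x * f (y / x)\<close> of \<open>f\<close>.\<close>

lemma spectral_mean_cdiag:
  fixes Y :: "real^'m::finite^'m"
  assumes Y: "invertible Y" and a: "\<And>i. 0 < a i"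
  shows "spectral_mean f (cdiag Y a) (cdiag Y m) = cdiag Y (\<lambda>i. a i * f (m i / a i))"
proof -
  have SPD: "cdiag Y a \<in> SPD" using Y a by (rule cdiag_SPD)
  obtain Z l where Z: "invertible Z" "cdiag Y a = cdiag Z (\<lambda>_. 1)" "cdiag Y m = cdiag Z l"
    "\<And>f. spectral_mean f (cdiag Y a) (cdiag Y m) = cdiag Z (\<lambda>i. f (l i))"
    by (rule simultaneous_diagonalisation[OF SPD transpose_cdiag[of Y m]]) (rule that)
  have "cdiag Y (\<lambda>i. a i * f (m i / a i)) = cdiag Z (\<lambda>i. 1 * f (l i / 1))"
    by (rule cdiag_homogeneous_fun_unique[where F = "\<lambda>x y. x * f (y / x)"])
       (simp_all add: Y Z(1-3) a)
  then show ?thesis by (simp add: Z(4))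
qed

lemma geometric_mean_cdiag:
  fixes Y :: "real^'m::finite^'m"
  assumes Y: "invertible Y" and a: "\<And>i. 0 < a i" and m: "\<And>i. 0 < m i"
  shows "cdiag Y a \<sharp> cdiag Y m = cdiag Y (\<lambda>i. sqrt (a i * m i))"
proof -
  have "x * (y / x) powr (1/2) = sqrt (x * y)" if "0 < x" "0 < y" for x y :: real
  proof -
    have "x * (y / x) powr (1/2) = (sqrt x * sqrt x) * (sqrt y / sqrt x)"
      using that by (simp add: powr_half_sqrt real_sqrt_divide)
    also have "\<dots> = sqrt (x * y)"
      using that by (simp add: real_sqrt_mult field_simps)
    finally show ?thesis .
  qed
  then show ?thesis
    using spectral_mean_cdiag[OF Y a, where f = "\<lambda>x. x powr (1/2)" and m = m] a m
    by (simp add: geometric_mean_def spectral_mean_def spd_powr_def)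
qed

text \<open>The product is similar to the diagonal matrix of the quotients, through the inverse transpose
  of \<open>Y\<close>.\<close>

lemma eigenvalues_cdiag:
  fixes Y :: "real^'m::finite^'m"
  assumes Y: "invertible Y" and a: "\<And>i. a i \<noteq> 0"
  shows "eigenvalues (matrix_inv (cdiag Y a) ** cdiag Y m) = range (\<lambda>i. m i / a i)"
proof -
  let ?Z = "transpose (matrix_inv Y)" and ?D = "diag_matrix (\<chi> i. m i / a i)"
  have inv: "invertible (transpose Y)" "invertible ?Z"
    using inverse_transpose_dual[OF Y] invertible_left_inverse invertible_right_inverse by blast+
  have ZY: "transpose ?Z ** Y = mat 1" "transpose Y ** ?Z = mat 1"
    using Y by (simp_all add: matrix_inv_left_right inverse_transpose_dual)
  have eq: "matrix_inv (cdiag Y a) ** cdiag Y m = ?Z ** ?D ** transpose Y"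
    using ZY by (simp add: matrix_inv_cdiag Y a cdiag_mult_dual)
  have D: "(?D *v x) $ i = m i / a i * x $ i" for x i
    by (simp add: matrix_vector_mult_def diag_matrix_def if_distrib[of "\<lambda>x. x * _"]
        cong: if_cong)
  have eig: "(?Z ** ?D ** transpose Y) *v (?Z *v x) = l *\<^sub>R (?Z *v x) \<longleftrightarrow> ?D *v x = l *\<^sub>R x" for x l
  proof -
    have "(?Z ** ?D ** transpose Y) *v (?Z *v x) = ?Z *v (?D *v x)"
      by (simp add: matrix_vector_mul_assoc matrix_mul_assoc[symmetric] ZY
          del: transpose_matrix_vector)
    then show ?thesis
      using invertible_mult_eq_0_iff[OF inv(2), of "?D *v x - l *\<^sub>R x"]
      by (simp add: matrix_vector_mult_diff_distrib matrix_vector_mult_scaleR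
          del: transpose_matrix_vector)
  qed
  show ?thesis
  proof (intro equalityI subsetI)
    fix l assume "l \<in> eigenvalues (matrix_inv (cdiag Y a) ** cdiag Y m)"
    then obtain v where v: "v \<noteq> 0" "(?Z ** ?D ** transpose Y) *v v = l *\<^sub>R v"
      by (auto simp: eigenvalues_def eq)
    define x where "x = transpose Y *v v"
    have vx: "v = ?Z *v x"
      using ZY(2)[unfolded matrix_left_right_inverse[of "transpose Y"]]
      by (simp only: x_def matrix_vector_mul_assoc matrix_vector_mul_lid)
    have "?D *v x = l *\<^sub>R x" using v(2) unfolding vx eig .
    then have "l * x $ i = m i / a i * x $ i" for i
      using D[of x i] by simp
    moreover have "x \<noteq> 0" using v(1) unfolding vx by auto
    then obtain i where "x $ i \<noteq> 0" by (auto simp: vec_eq_iff)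
    ultimately have "l = m i / a i"
      by (metis mult_right_cancel)
    then show "l \<in> range (\<lambda>i. m i / a i)" by blast
  next
    fix l assume "l \<in> range (\<lambda>i. m i / a i)"
    then obtain i where l: "l = m i / a i" by auto
    have "?D *v axis i 1 = l *\<^sub>R axis i 1"
      unfolding vec_eq_iff D by (auto simp: l axis_def)
    moreover have "?Z *v axis i 1 \<noteq> 0"
      by (simp add: invertible_mult_eq_0_iff inv axis_eq_0_iff del: transpose_matrix_vector)
    ultimately show "l \<in> eigenvalues (matrix_inv (cdiag Y a) ** cdiag Y m)"
      unfolding eigenvalues_def eq mem_Collect_eq using eig by blast
  qed
qed

section \<open>Gronwall estimate and continuity of inversion\<close>

text \<open>By Gronwall, \<open>exp (- 2 K t) * norm (y t)\<^sup>2\<close> is nonincreasing, and it starts at 0.\<close>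

lemma linear_ode_zero:
  fixes y :: "real \<Rightarrow> 'a::real_inner"
  assumes der: "\<And>t. t \<in> {0..1} \<Longrightarrow> (y has_vector_derivative y' t) (at t within {0..1})"
    and bound: "\<And>t. t \<in> {0..1} \<Longrightarrow> norm (y' t) \<le> K * norm (y t)"
    and y0: "y 0 = 0" and t: "t \<in> {0..1}"
  shows "y t = 0"
proof (cases "t = 0")
  case False
  define h where "h s = exp (- (2 * K * s)) * (y s \<bullet> y s)" for s
  have dh: "(h has_real_derivative exp (- (2 * K * s)) * (2 * (y s \<bullet> y' s) - 2 * K * (y s \<bullet> y s)))
      (at s within {0..1})" if s: "s \<in> {0..1}" for s
  proof -
    have "((\<lambda>s. y s \<bullet> y s) has_real_derivative y s \<bullet> y' s + y' s \<bullet> y s) (at s within {0..1})"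
      using bounded_bilinear.has_vector_derivative[OF bounded_bilinear_inner der[OF s] der[OF s]]
      by (simp add: has_real_derivative_iff_has_vector_derivative)
    then show ?thesis
      unfolding h_def by (auto intro!: derivative_eq_intros simp: inner_commute algebra_simps)
  qed
  have "h t \<le> h 0"
  proof (rule DERIV_nonpos_imp_decreasing_open[of 0 t h])
    show "0 \<le> t" using t by simp
    show "continuous_on {0..t} h"
      by (rule continuous_on_subset[of "{0..1}"])
         (use t in \<open>auto simp: continuous_on_eq_continuous_within intro: DERIV_continuous[OF dh]\<close>)
    fix s assume s: "0 < s" "s < t"
    then have "y s \<bullet> y' s \<le> norm (y s) * (K * norm (y s))"
      using t norm_cauchy_schwarz[of "y s" "y' s"] mult_left_mono[OF bound[of s], of "norm (y s)"]
      by simp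
    then have "2 * (y s \<bullet> y' s) - 2 * K * (y s \<bullet> y s) \<le> 0"
      by (simp add: power2_norm_eq_inner[symmetric] power2_eq_square mult_ac)
    moreover have "at s within {0..1} = at s"
      using s t by (simp add: at_within_Icc_at)
    ultimately show "\<exists>d. (h has_real_derivative d) (at s) \<and> d \<le> 0"
      using dh[of s] s t by (auto simp: mult_nonneg_nonpos intro!: exI)
  qed
  then have "exp (- (2 * K * t)) * (y t \<bullet> y t) \<le> 0" by (simp add: h_def y0)
  then have "y t \<bullet> y t \<le> 0" by (simp add: mult_le_0_iff not_le)
  then show ?thesis by (metis inner_ge_zero inner_eq_zero_iff order_antisym)
qed (simp add: y0)

lemma continuous_on_det:
  fixes F :: "'a::topological_space \<Rightarrow> real^'m::finite^'m"
  assumes "\<And>i j. continuous_on S (\<lambda>t. F t $ i $ j)"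
  shows "continuous_on S (\<lambda>t. det (F t))"
  unfolding det_def by (intro continuous_intros assms)

text \<open>By Cramer's rule the entries of the inverse are quotients of determinants.\<close>

lemma continuous_on_matrix_inv:
  fixes F :: "'a::topological_space \<Rightarrow> real^'m::finite^'m"
  assumes F: "continuous_on S F" and inv: "\<And>t. t \<in> S \<Longrightarrow> invertible (F t)"
  shows "continuous_on S (\<lambda>t. matrix_inv (F t))"
proof -
  have c: "continuous_on S (\<lambda>t. F t $ i $ j)" for i j
    by (intro continuous_intros F)
  have d: "det (F t) \<noteq> 0" if "t \<in> S" for t
    using inv[OF that] by (simp add: invertible_det_nz)
  have "continuous_on S (\<lambda>t. (\<chi> i k. det (\<chi> r c. if c = i then axis k 1 $ r else F t $ r $ c)
      / det (F t)) :: real^'m^'m)"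
  proof (intro continuous_on_vec_lambda continuous_on_divide continuous_on_det c ballI d)
    fix i k r c' :: 'm
    show "continuous_on S (\<lambda>t. (\<chi> r c. if c = i then axis k 1 $ r else F t $ r $ c) $ r $ c')"
      using c by (cases "c' = i") (auto intro!: continuous_intros)
  qed
  then show ?thesis
    by (rule continuous_on_eq) (simp add: matrix_inv_cramer d)
qed

section \<open>The geodesic equation, its scalar solutions, and power means\<close>

lemma christoffel_nabla_alpha:
  "christoffel (nabla_alpha \<alpha>) P V V = - ((1 - \<alpha>) *\<^sub>R (V ** matrix_inv P ** V))"
proof -
  let ?M = "V ** matrix_inv P ** V"
  have E: "nabla_E (\<lambda>_. V) (\<lambda>_. V) P = 0" by (simp add: nabla_E_def)
  have "(1/2) *\<^sub>R (?M + ?M) = ?M"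
    by (simp only: scaleR_2[symmetric] scaleR_scaleR) simp
  then show ?thesis
    by (simp add: christoffel_def nabla_alpha_def nabla_g_def E scaleR_left_diff_distrib)
qed

lemma affine_geodesic_alpha_iff:
  "affine_geodesic (nabla_alpha \<alpha>) \<gamma> \<longleftrightarrow> (\<exists>\<gamma>' \<gamma>''. \<forall>t\<in>{0..1}. \<gamma> t \<in> SPD \<and>
     (\<gamma> has_vector_derivative \<gamma>' t) (at t within {0..1}) \<and>
     (\<gamma>' has_vector_derivative \<gamma>'' t) (at t within {0..1}) \<and>
     \<gamma>'' t = (1 - \<alpha>) *\<^sub>R (\<gamma>' t ** matrix_inv (\<gamma> t) ** \<gamma>' t))"
  by (simp add: affine_geodesic_def christoffel_nabla_alpha)

text \<open>The power mean with exponent \<open>\<alpha>\<close>, where exponent 0 stands for the limit.\<close>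

definition pow_mean :: "real \<Rightarrow> real \<Rightarrow> real \<Rightarrow> real" where
  "pow_mean \<alpha> x y = (if \<alpha> = 0 then sqrt (x * y) else ((x powr \<alpha> + y powr \<alpha>) / 2) powr (1 / \<alpha>))"

text \<open>The scalar geodesic from 1 with initial velocity \<open>\<mu>\<close>: it solves
  \<open>g g'' = (1 - \<alpha>) (g')\<^sup>2\<close>, which says that \<open>g powr \<alpha>\<close> (for \<open>\<alpha> = 0\<close>, \<open>ln g\<close>) is affine in \<open>t\<close>.\<close>

definition geodesic_profile :: "real \<Rightarrow> real \<Rightarrow> real \<Rightarrow> real" where
  "geodesic_profile \<alpha> \<mu> t = (if \<alpha> = 0 then exp (\<mu> * t) else (1 + \<alpha> * t * \<mu>) powr (1 / \<alpha>))"

lemma geodesic_profile_0 [simp]: "geodesic_profile \<alpha> \<mu> 0 = 1"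
  by (simp add: geodesic_profile_def)

lemma geodesic_profile_pos: "0 < 1 + \<alpha> * t * \<mu> \<Longrightarrow> 0 < geodesic_profile \<alpha> \<mu> t"
  by (auto simp: geodesic_profile_def)

text \<open>Written through the logarithmic derivative, which has the same form for
  \<open>\<alpha> = 0\<close> as for all other exponents.\<close>

lemma has_real_derivative_geodesic_profile:
  assumes "0 < 1 + \<alpha> * t * \<mu>"
  shows "(geodesic_profile \<alpha> \<mu> has_real_derivative
    \<mu> / (1 + \<alpha> * t * \<mu>) * geodesic_profile \<alpha> \<mu> t) (at t within T)"
proof (cases "\<alpha> = 0")
  case True
  then show ?thesis
    unfolding geodesic_profile_def by (auto intro!: derivative_eq_intros)
next
  case False
  have "((\<lambda>t. 1 + \<alpha> * t * \<mu>) has_real_derivative \<alpha> * \<mu>) (at t)"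
    by (auto intro!: derivative_eq_intros)
  from DERIV_fun_powr[OF this assms, of "1 / \<alpha>"]
  have "((\<lambda>t. (1 + \<alpha> * t * \<mu>) powr (1 / \<alpha>)) has_real_derivative
      \<mu> / (1 + \<alpha> * t * \<mu>) * (1 + \<alpha> * t * \<mu>) powr (1 / \<alpha>)) (at t within T)"
    using assms False by (simp add: powr_diff has_field_derivative_at_within mult.commute[of \<mu>])
  then show ?thesis by (simp add: geodesic_profile_def[abs_def] False)
qed

lemma geodesic_profile_mid:
  assumes "0 < 1 + \<alpha> * \<mu>"
  shows "geodesic_profile \<alpha> \<mu> (1/2) = pow_mean \<alpha> 1 (geodesic_profile \<alpha> \<mu> 1)"
proof (cases "\<alpha> = 0")
  case True
  have "exp \<mu> = (exp (\<mu> / 2))\<^sup>2" by (simp add: exp_double[symmetric])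
  then have "sqrt (exp \<mu>) = exp (\<mu> / 2)" by (simp add: real_sqrt_unique)
  then show ?thesis by (simp add: geodesic_profile_def pow_mean_def True)
next
  case False
  then show ?thesis using assms
    by (simp add: geodesic_profile_def pow_mean_def powr_powr field_simps)
qed

text \<open>The velocity is \<open>(l powr \<alpha> - 1) / \<alpha>\<close>, respectively \<open>ln l\<close>. In the first case the base
  of the power is the convex combination of 1 and \<open>l powr \<alpha>\<close>, whence its positivity on \<open>[0,1]\<close>.\<close>

lemma geodesic_profile_endpoint:
  assumes "0 < l"
  obtains \<mu> where "\<And>t. t \<in> {0..1} \<Longrightarrow> 0 < 1 + \<alpha> * t * \<mu>" "geodesic_profile \<alpha> \<mu> 1 = l"
proof (cases "\<alpha> = 0")
  case True
  then show thesis using assms by (intro that[of "ln l"]) (auto simp: geodesic_profile_def)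
next
  case False
  let ?\<mu> = "(l powr \<alpha> - 1) / \<alpha>"
  have eq: "1 + \<alpha> * t * ?\<mu> = (1 - t) * 1 + t * l powr \<alpha>" for t
    using False by (simp add: field_simps)
  have "0 < 1 + \<alpha> * t * ?\<mu>" if "t \<in> {0..1}" for t
    unfolding eq using that assms by (cases "t = 0") (auto intro!: add_nonneg_pos)
  moreover have "geodesic_profile \<alpha> ?\<mu> 1 = l"
    using assms False by (simp add: geodesic_profile_def powr_powr)
  ultimately show thesis by (rule that)
qed

lemma pow_mean_homogeneous:
  assumes "0 < c" "0 < x" "0 < y"
  shows "pow_mean \<alpha> (c * x) (c * y) = c * pow_mean \<alpha> x y"
proof (cases "\<alpha> = 0")
  case True
  have "sqrt (c * x * (c * y)) = sqrt (c\<^sup>2 * (x * y))" by (simp add: power2_eq_square mult_ac)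
  then show ?thesis using assms True by (simp add: pow_mean_def real_sqrt_mult)
next
  case False
  have "((c * x) powr \<alpha> + (c * y) powr \<alpha>) / 2 = c powr \<alpha> * ((x powr \<alpha> + y powr \<alpha>) / 2)"
    using assms by (simp add: powr_mult field_simps)
  moreover have "(c powr \<alpha> * ((x powr \<alpha> + y powr \<alpha>) / 2)) powr (1 / \<alpha>)
      = c * ((x powr \<alpha> + y powr \<alpha>) / 2) powr (1 / \<alpha>)"
    using assms False by (subst powr_mult) (simp_all add: powr_powr)
  ultimately show ?thesis using False by (simp only: pow_mean_def if_False)
qed

section \<open>Geodesics and their midpoints\<close>

lemma bounded_bilinear_matrix_vector_mult:
  "bounded_bilinear ((*v) :: real^'m::finite^'m \<Rightarrow> real^'m \<Rightarrow> real^'m)"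
  unfolding bilinear_conv_bounded_bilinear[symmetric] bilinear_def
  by (auto intro!: linearI simp: vec_eq_iff matrix_vector_mult_def algebra_simps
      sum.distrib sum_distrib_left)

text \<open>The rigidity behind the uniqueness of midpoints. The vector
  \<open>y(t) = (1 + \<alpha> t \<mu>) \<gamma>'(t) x - \<mu> \<gamma>(t) x\<close> vanishes at 0, and the geodesic equation turns into the
  linear equation \<open>y' = (1 - \<alpha>) \<gamma>' \<gamma>\<^sup>-\<^sup>1 y\<close>, so \<open>y\<close> vanishes identically. In particular
  \<open>1 + \<alpha> t \<mu>\<close> has no zero, because \<open>\<gamma>(t) x\<close> has none, and so stays positive. What remains is the scalar
  equation \<open>(\<gamma> x)' = \<mu> / (1 + \<alpha> t \<mu>) \<gamma> x\<close>, solved by the profile.\<close>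

lemma geodesic_eigenvector:
  fixes \<gamma> :: "real \<Rightarrow> real^'m::finite^'m"
  assumes SPD: "\<And>t. t \<in> {0..1} \<Longrightarrow> \<gamma> t \<in> SPD"
    and D1: "\<And>t. t \<in> {0..1} \<Longrightarrow> (\<gamma> has_vector_derivative \<gamma>' t) (at t within {0..1})"
    and D2: "\<And>t. t \<in> {0..1} \<Longrightarrow> (\<gamma>' has_vector_derivative
       (1 - \<alpha>) *\<^sub>R (\<gamma>' t ** matrix_inv (\<gamma> t) ** \<gamma>' t)) (at t within {0..1})"
    and x: "\<gamma>' 0 *v x = \<mu> *\<^sub>R (\<gamma> 0 *v x)" "x \<noteq> 0"
    and t: "t \<in> {0..1}"
  shows "0 < 1 + \<alpha> * t * \<mu>" and "\<gamma> t *v x = geodesic_profile \<alpha> \<mu> t *\<^sub>R (\<gamma> 0 *v x)"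
proof -
  interpret B: bounded_bilinear "(*v) :: real^'m^'m \<Rightarrow> real^'m \<Rightarrow> real^'m"
    by (rule bounded_bilinear_matrix_vector_mult)
  have lin: "bounded_linear (\<lambda>A :: real^'m^'m. A *v x)" for x by (rule B.bounded_linear_left)
  define J where "J t = matrix_inv (\<gamma> t)" for t
  define y where "y s = (1 + \<alpha> * s * \<mu>) *\<^sub>R (\<gamma>' s *v x) - \<mu> *\<^sub>R (\<gamma> s *v x)" for s
  have y_der: "(y has_vector_derivative (1 - \<alpha>) *\<^sub>R (\<gamma>' s ** J s *v y s)) (at s within {0..1})"
    if s: "s \<in> {0..1}" for s
  proof -
    have "J s *v (\<gamma> s *v x) = x"
      using matrix_inv_left_right[OF SPD_invertible[OF SPD[OF s]]]
      by (simp add: J_def matrix_vector_mul_assoc)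
    then have J: "\<gamma>' s ** J s *v (\<gamma> s *v x) = \<gamma>' s *v x"
      by (simp only: matrix_vector_mul_assoc[symmetric])
    have 1: "((\<lambda>s. 1 + \<alpha> * s * \<mu>) has_real_derivative \<alpha> * \<mu>) (at s within {0..1})"
      by (auto intro!: derivative_eq_intros)
    have "(y has_vector_derivative
        ((1 + \<alpha> * s * \<mu>) *\<^sub>R ((1 - \<alpha>) *\<^sub>R (\<gamma>' s ** J s ** \<gamma>' s) *v x) + (\<alpha> * \<mu>) *\<^sub>R (\<gamma>' s *v x))
        - \<mu> *\<^sub>R (\<gamma>' s *v x)) (at s within {0..1})"
      unfolding y_def J_def
      by (intro has_vector_derivative_diff has_vector_derivative_scaleR[OF 1]
          bounded_linear.has_vector_derivative[OF lin D1[OF s]]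
          bounded_linear.has_vector_derivative[OF lin D2[OF s]]
          bounded_linear.has_vector_derivative[OF bounded_linear_scaleR_right])
    moreover have "((1 + \<alpha> * s * \<mu>) *\<^sub>R ((1 - \<alpha>) *\<^sub>R (\<gamma>' s ** J s ** \<gamma>' s) *v x) + (\<alpha> * \<mu>) *\<^sub>R (\<gamma>' s *v x))
        - \<mu> *\<^sub>R (\<gamma>' s *v x) = (1 - \<alpha>) *\<^sub>R (\<gamma>' s ** J s *v y s)"
      unfolding y_def B.diff_right B.scaleR_right B.scaleR_left J
      by (simp add: matrix_vector_mul_assoc algebra_simps)
    ultimately show ?thesis by simp
  qed
  have "continuous_on {0..1} \<gamma>" "continuous_on {0..1} \<gamma>'"
    using D1 D2 by (meson has_vector_derivative_continuous continuous_on_eq_continuous_within)+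
  then have "continuous_on {0..1} (\<lambda>s. \<gamma>' s ** J s)"
    unfolding J_def
    by (intro bounded_bilinear.continuous_on[OF bounded_bilinear_matrix_mult]
        continuous_on_matrix_inv SPD_invertible SPD)
  then have "bounded ((\<lambda>s. \<gamma>' s ** J s) ` {0..1})"
    by (intro compact_imp_bounded compact_continuous_image) auto
  then obtain M where "\<forall>s\<in>{0..1}. norm (\<gamma>' s ** J s) \<le> M"
    by (auto simp: bounded_iff)
  then have M: "\<And>s. s \<in> {0..1} \<Longrightarrow> norm (\<gamma>' s ** J s) \<le> M" by blast
  obtain C where C: "0 \<le> C" "\<And>(A::real^'m^'m) v. norm (A *v v) \<le> norm A * norm v * C"
    using B.nonneg_bounded by blast
  have y_bound: "norm ((1 - \<alpha>) *\<^sub>R (\<gamma>' s ** J s *v y s)) \<le> (\<bar>1 - \<alpha>\<bar> * M * C) * norm (y s)"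
    if "s \<in> {0..1}" for s
  proof -
    have "norm (\<gamma>' s ** J s *v y s) \<le> M * norm (y s) * C"
      using C(2)[of "\<gamma>' s ** J s" "y s"] M[OF that] C(1)
      by (meson mult_right_mono norm_ge_zero order_trans)
    then have "\<bar>1 - \<alpha>\<bar> * norm (\<gamma>' s ** J s *v y s) \<le> \<bar>1 - \<alpha>\<bar> * (M * norm (y s) * C)"
      by (intro mult_left_mono) auto
    then show ?thesis by (simp add: mult_ac)
  qed
  have y0: "y s = 0" if "s \<in> {0..1}" for s
    by (rule linear_ode_zero[OF y_der y_bound _ that]) (simp_all add: y_def x)
  have nz: "1 + \<alpha> * s * \<mu> \<noteq> 0" if s: "s \<in> {0..1}" for s
  proof
    assume 0: "1 + \<alpha> * s * \<mu> = 0"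
    then have "\<mu> \<noteq> 0" by auto
    with 0 y0[OF s] have "\<gamma> s *v x = 0" by (simp add: y_def)
    then show False using x(2) invertible_mult_eq_0_iff SPD_invertible[OF SPD[OF s]] by blast
  qed
  have pos: "0 < 1 + \<alpha> * s * \<mu>" if s: "s \<in> {0..1}" for s
  proof (rule ccontr)
    assume "\<not> 0 < 1 + \<alpha> * s * \<mu>"
    then have "\<alpha> * s * \<mu> \<le> -1" by simp
    then have "s * (\<alpha> * \<mu>) < 0" by (simp add: mult_ac)
    then have neg: "\<alpha> * \<mu> < 0" using s by (auto simp: mult_less_0_iff)
    have "s * (\<alpha> * \<mu>) \<ge> 1 * (\<alpha> * \<mu>)" using s neg by (intro mult_right_mono_neg) auto
    then have "\<alpha> * \<mu> \<le> -1" using \<open>\<alpha> * s * \<mu> \<le> -1\<close> by (simp add: mult_ac)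
    \<comment> \<open>The affine function \<open>1 + \<alpha> s \<mu>\<close> would then already have its zero in \<open>[0,1]\<close>.\<close>
    then have "- 1 / (\<alpha> * \<mu>) \<in> {0..1}" by (simp add: field_simps)
    moreover have "\<alpha> \<noteq> 0" "\<mu> \<noteq> 0" using neg by auto
    ultimately show False using nz[of "- 1 / (\<alpha> * \<mu>)"] by simp
  qed
  then show "0 < 1 + \<alpha> * t * \<mu>" using t .
  define g where "g = geodesic_profile \<alpha> \<mu>"
  define u where "u s = (1 / g s) *\<^sub>R (\<gamma> s *v x) - \<gamma> 0 *v x" for s
  have "(u has_vector_derivative 0) (at s within {0..1})" if s: "s \<in> {0..1}" for s
  proof -
    define k where "k = \<mu> / (1 + \<alpha> * s * \<mu>)"
    have gs: "g s > 0" using geodesic_profile_pos[OF pos[OF s]] by (simp add: g_def)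
    have "(g has_real_derivative k * g s) (at s within {0..1})"
      unfolding g_def k_def by (rule has_real_derivative_geodesic_profile[OF pos[OF s]])
    from DERIV_inverse'[OF this]
    have dg: "((\<lambda>s. 1 / g s) has_real_derivative - (k / g s)) (at s within {0..1})"
      using gs by (simp add: field_simps)
    have "(1 + \<alpha> * s * \<mu>) *\<^sub>R (\<gamma>' s *v x) = \<mu> *\<^sub>R (\<gamma> s *v x)"
      using y0[OF s] by (simp add: y_def)
    then have "\<gamma>' s *v x = k *\<^sub>R (\<gamma> s *v x)"
      using pos[OF s] eq_vector_fraction_iff[of "\<gamma>' s *v x" \<mu> "1 + \<alpha> * s * \<mu>" "\<gamma> s *v x"]
      by (simp add: k_def)
    then have eq: "(1 / g s) *\<^sub>R (\<gamma>' s *v x) + (- (k / g s)) *\<^sub>R (\<gamma> s *v x) - 0 = 0"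
      by simp
    show ?thesis
      unfolding u_def
      by (rule has_vector_derivative_eq_rhs[OF _ eq])
         (intro has_vector_derivative_diff has_vector_derivative_scaleR[OF dg]
          bounded_linear.has_vector_derivative[OF lin D1[OF s]] has_vector_derivative_const)
  qed
  then have "u t = 0"
    by (rule linear_ode_zero[where K = 0, OF _ _ _ t]) (simp_all add: u_def g_def)
  then show "\<gamma> t *v x = geodesic_profile \<alpha> \<mu> t *\<^sub>R (\<gamma> 0 *v x)"
    using geodesic_profile_pos[OF pos[OF t]]
      eq_vector_fraction_iff[of "\<gamma> 0 *v x" 1 "g t" "\<gamma> t *v x"]
    by (simp add: u_def g_def)
qed

lemma cdiag_component: "cdiag Y d $ i $ j = (\<Sum>k\<in>UNIV. Y $ i $ k * d k * Y $ j $ k)"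
  for Y :: "real^'m::finite^'m"
  by (simp add: cdiag_def matrix_matrix_mult_def[of "Y ** _"] matrix_mult_diag_component transpose_def)

lemma cdiag_eq_sum: "cdiag Y d = (\<Sum>k\<in>UNIV. d k *\<^sub>R cdiag Y (\<lambda>j. if j = k then 1 else 0))"
  for Y :: "real^'m::finite^'m"
  by (simp add: vec_eq_iff cdiag_component if_distrib[of "\<lambda>x. _ * x"] if_distrib[of "\<lambda>x. x * _"]
      mult_ac cong: if_cong)

lemma has_vector_derivative_cdiag:
  fixes Y :: "real^'m::finite^'m"
  assumes "\<And>i. ((\<lambda>t. f t i) has_real_derivative f' i) (at t within T)"
  shows "((\<lambda>t. cdiag Y (f t)) has_vector_derivative cdiag Y f') (at t within T)"
proof -
  have "((\<lambda>t. \<Sum>k\<in>UNIV. f t k *\<^sub>R cdiag Y (\<lambda>j. if j = k then 1 else 0)) has_vector_derivative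
      (\<Sum>k\<in>UNIV. f t k *\<^sub>R 0 + f' k *\<^sub>R cdiag Y (\<lambda>j. if j = k then 1 else 0))) (at t within T)"
    by (intro has_vector_derivative_sum has_vector_derivative_scaleR assms has_vector_derivative_const)
  then show ?thesis by (simp add: cdiag_eq_sum[symmetric])
qed

lemma tendsto_cdiag:
  fixes Y :: "real^'m::finite^'m"
  assumes "\<And>i. ((\<lambda>n. f n i) \<longlongrightarrow> l i) F"
  shows "((\<lambda>n. cdiag Y (f n)) \<longlongrightarrow> cdiag Y l) F"
  by (subst (1 2) cdiag_eq_sum) (intro tendsto_sum tendsto_scaleR assms tendsto_const)

lemma cdiag_mult_inv_mult:
  fixes Y :: "real^'m::finite^'m"
  assumes Y: "invertible Y" and h: "\<And>i. h i \<noteq> 0"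
  shows "cdiag Y d ** matrix_inv (cdiag Y h) ** cdiag Y e = cdiag Y (\<lambda>i. d i * e i / h i)"
proof -
  have "cdiag Y d ** matrix_inv (cdiag Y h) ** cdiag Y e
    = Y ** diag_matrix (\<chi> i. d i / h i) ** (matrix_inv Y ** Y) ** diag_matrix (\<chi> i. e i) ** transpose Y"
    by (simp add: matrix_inv_cdiag Y h cdiag_mult_dual inverse_transpose_dual)
       (simp add: cdiag_def matrix_mul_assoc)
  also have "\<dots> = Y ** (diag_matrix (\<chi> i. d i / h i) ** diag_matrix (\<chi> i. e i)) ** transpose Y"
    by (simp add: matrix_inv_left_right Y matrix_mul_assoc)
  finally show ?thesis by (simp add: diag_matrix_mult cdiag_def)
qed

text \<open>With \<open>k\<close> the logarithmic derivative of a profile, the geodesic equation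
  reduces to the Riccati equation \<open>k' = - \<alpha> k\<^sup>2\<close>.\<close>

lemma affine_geodesic_cdiag_profile:
  fixes Y :: "real^'m::finite^'m"
  assumes Y: "invertible Y" and a: "\<And>i. 0 < a i"
    and \<mu>: "\<And>i t. t \<in> {0..1} \<Longrightarrow> 0 < 1 + \<alpha> * t * \<mu> i"
  shows "affine_geodesic (nabla_alpha \<alpha>) (\<lambda>t. cdiag Y (\<lambda>i. a i * geodesic_profile \<alpha> (\<mu> i) t))"
proof -
  define h where "h t i = a i * geodesic_profile \<alpha> (\<mu> i) t" for t i
  define k where "k t i = \<mu> i / (1 + \<alpha> * t * \<mu> i)" for t i
  have h_pos: "0 < h t i" if "t \<in> {0..1}" for t i
    unfolding h_def using a geodesic_profile_pos[OF \<mu>[OF that]] by simp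
  have h': "((\<lambda>t. h t i) has_real_derivative k t i * h t i) (at t within {0..1})"
    if "t \<in> {0..1}" for t i
    using DERIV_cmult[OF has_real_derivative_geodesic_profile[OF \<mu>[OF that]], of "a i"]
    by (simp add: h_def k_def mult_ac)
  have k': "((\<lambda>t. k t i) has_real_derivative - \<alpha> * (k t i)\<^sup>2) (at t within {0..1})"
    if "t \<in> {0..1}" for t i
    unfolding k_def using \<mu>[OF that, of i]
    by (auto intro!: derivative_eq_intros simp: power2_eq_square)
  have h'': "((\<lambda>t. k t i * h t i) has_real_derivative (1 - \<alpha>) * (k t i)\<^sup>2 * h t i) (at t within {0..1})"
    if "t \<in> {0..1}" for t i
    by (rule DERIV_cong[OF DERIV_mult[OF k'[OF that] h'[OF that]]])
       (simp add: algebra_simps power2_eq_square)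
  have "affine_geodesic (nabla_alpha \<alpha>) (\<lambda>t. cdiag Y (h t))"
    unfolding affine_geodesic_alpha_iff
  proof (intro exI ballI conjI)
    fix t :: real assume t: "t \<in> {0..1}"
    show "cdiag Y (h t) \<in> SPD" using Y h_pos[OF t] by (rule cdiag_SPD)
    show "((\<lambda>t. cdiag Y (h t)) has_vector_derivative cdiag Y (\<lambda>i. k t i * h t i)) (at t within {0..1})"
      by (rule has_vector_derivative_cdiag[OF h'[OF t]])
    show "((\<lambda>t. cdiag Y (\<lambda>i. k t i * h t i)) has_vector_derivative
        cdiag Y (\<lambda>i. (1 - \<alpha>) * (k t i)\<^sup>2 * h t i)) (at t within {0..1})"
      by (rule has_vector_derivative_cdiag[OF h''[OF t]])
    have h0: "h t i \<noteq> 0" for i using h_pos[OF t, of i] by simp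
    have "cdiag Y (\<lambda>i. k t i * h t i) ** matrix_inv (cdiag Y (h t)) ** cdiag Y (\<lambda>i. k t i * h t i)
        = cdiag Y (\<lambda>i. (k t i)\<^sup>2 * h t i)"
      using h0 by (simp add: cdiag_mult_inv_mult Y power2_eq_square mult_ac)
    then show "cdiag Y (\<lambda>i. (1 - \<alpha>) * (k t i)\<^sup>2 * h t i) = (1 - \<alpha>) *\<^sub>R
       (cdiag Y (\<lambda>i. k t i * h t i) ** matrix_inv (cdiag Y (h t)) ** cdiag Y (\<lambda>i. k t i * h t i))"
      by (simp add: vec_eq_iff cdiag_component sum_distrib_left mult_ac)
  qed
  then show ?thesis by (simp add: h_def[abs_def])
qed

text \<open>The initial velocity is symmetric, so it is diagonal in a common basis \<open>Y\<close> with the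
  initial point. The vectors of the basis dual to the columns of \<open>Y\<close> are then eigenvectors to which rigidity
  applies, and they determine the whole curve.\<close>

lemma affine_geodesic_imp_profile:
  fixes \<gamma> :: "real \<Rightarrow> real^'m::finite^'m"
  assumes geo: "affine_geodesic (nabla_alpha \<alpha>) \<gamma>"
  obtains Y \<mu> where "invertible Y" "\<And>i. 0 < 1 + \<alpha> * \<mu> i"
    "\<And>t. t \<in> {0..1} \<Longrightarrow> \<gamma> t = cdiag Y (\<lambda>i. geodesic_profile \<alpha> (\<mu> i) t)"
proof -
  obtain \<gamma>' \<gamma>'' where G: "\<forall>t\<in>{0..1}. \<gamma> t \<in> SPD \<and>
     (\<gamma> has_vector_derivative \<gamma>' t) (at t within {0..1}) \<and>
     (\<gamma>' has_vector_derivative \<gamma>'' t) (at t within {0..1}) \<and>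
     \<gamma>'' t = (1 - \<alpha>) *\<^sub>R (\<gamma>' t ** matrix_inv (\<gamma> t) ** \<gamma>' t)"
    using geo unfolding affine_geodesic_alpha_iff by blast
  then have SPD: "\<And>t. t \<in> {0..1} \<Longrightarrow> \<gamma> t \<in> SPD"
    and D1: "\<And>t. t \<in> {0..1} \<Longrightarrow> (\<gamma> has_vector_derivative \<gamma>' t) (at t within {0..1})"
    and D2: "\<And>t. t \<in> {0..1} \<Longrightarrow> (\<gamma>' has_vector_derivative
       (1 - \<alpha>) *\<^sub>R (\<gamma>' t ** matrix_inv (\<gamma> t) ** \<gamma>' t)) (at t within {0..1})"
    by metis+
  have sym: "transpose (\<gamma>' 0) = \<gamma>' 0"
  proof -
    have lin: "bounded_linear (transpose :: real^'m^'m \<Rightarrow> real^'m^'m)"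
      unfolding linear_conv_bounded_linear[symmetric]
      by (auto intro!: linearI simp: vec_eq_iff transpose_def)
    have "((\<lambda>t. transpose (\<gamma> t)) has_vector_derivative transpose (\<gamma>' 0)) (at 0 within {0..1})"
      by (rule bounded_linear.has_vector_derivative[OF lin D1]) simp
    then have "(\<gamma> has_vector_derivative transpose (\<gamma>' 0)) (at 0 within {0..1})"
      by (rule has_vector_derivative_transform[rotated 2]) (use SPD in \<open>auto simp: SPD_def\<close>)
    then show ?thesis
      using vector_derivative_unique_within_closed_interval[of 0 1 0 \<gamma>] D1[of 0] by auto
  qed
  have SPD0: "\<gamma> 0 \<in> SPD" using SPD by simp
  obtain Y \<mu> where Y: "invertible Y" and P: "\<gamma> 0 = cdiag Y (\<lambda>_. 1)" and V: "\<gamma>' 0 = cdiag Y \<mu>"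
    by (rule simultaneous_diagonalisation[OF SPD0 sym]) (rule that)
  define Z where "Z = transpose (matrix_inv Y)"
  have YZ: "transpose Y ** Z = mat 1" using inverse_transpose_dual[OF Y] by (simp add: Z_def)
  then have ZY: "Z ** transpose Y = mat 1" by (simp add: matrix_left_right_inverse)
  have dZ: "cdiag Y d *v (Z *v axis i 1) = d i *\<^sub>R (Y *v axis i 1)" for d i
  proof -
    have "cdiag Y d ** Z = Y ** diag_matrix (\<chi> i. d i)"
      by (simp add: cdiag_def matrix_mul_assoc[symmetric] YZ)
    then have "cdiag Y d *v (Z *v axis i 1) = (Y ** diag_matrix (\<chi> i. d i)) *v axis i 1"
      by (simp add: matrix_vector_mul_assoc)
    also have "\<dots> = d i *\<^sub>R (Y *v axis i 1)"
      by (simp add: matrix_vector_mult_basis vec_eq_iff column_def matrix_mult_diag_component)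
    finally show ?thesis .
  qed
  have ev: "\<gamma>' 0 *v (Z *v axis i 1) = \<mu> i *\<^sub>R (\<gamma> 0 *v (Z *v axis i 1))" for i
    by (simp only: P V dZ) simp
  have nz: "Z *v axis i 1 \<noteq> 0" for i
  proof
    assume "Z *v axis i 1 = 0"
    then have "transpose Y *v (Z *v axis i 1) = 0" by (simp only: matrix_vector_mult_0_right)
    then have "axis i 1 = (0 :: real^'m)"
      by (simp only: matrix_vector_mul_assoc YZ matrix_vector_mul_lid)
    then show False by (simp add: axis_eq_0_iff)
  qed
  note E = geodesic_eigenvector[OF SPD D1 D2 ev nz]
  show thesis
  proof (rule that[OF Y])
    show "0 < 1 + \<alpha> * \<mu> i" for i using E(1)[of 1 i] by simp
    fix t :: real assume t: "t \<in> {0..1}"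
    let ?C = "cdiag Y (\<lambda>i. geodesic_profile \<alpha> (\<mu> i) t)"
    have "(\<gamma> t ** Z) *v axis i 1 = (?C ** Z) *v axis i 1" for i
      using E(2)[OF _ _ _ t, of i] by (simp add: matrix_vector_mul_assoc[symmetric] dZ P)
    then have "\<gamma> t ** Z = ?C ** Z"
      by (simp add: matrix_vector_mult_basis vec_eq_iff column_def)
    then have "\<gamma> t ** (Z ** transpose Y) = ?C ** (Z ** transpose Y)"
      by (simp only: matrix_mul_assoc)
    then show "\<gamma> t = ?C" by (simp add: ZY)
  qed
qed

text \<open>Profiles with the right velocities give a geodesic with the prescribed ends. Any
  other one is also diagonal, in a possibly different basis; since the power mean is homogeneous, its midpoint
  is the same.\<close>

theorem midpoint_map_nabla_alpha_cdiag:
  fixes Y :: "real^'m::finite^'m"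
  assumes Y: "invertible Y" and a: "\<And>i. 0 < a i" and m: "\<And>i. 0 < m i"
  shows "midpoint_map (nabla_alpha \<alpha>) (cdiag Y a) (cdiag Y m) = cdiag Y (\<lambda>i. pow_mean \<alpha> (a i) (m i))"
  unfolding midpoint_map_def
proof (rule the_equality)
  have "\<exists>\<mu>. (\<forall>t\<in>{0..1}. 0 < 1 + \<alpha> * t * \<mu>) \<and> geodesic_profile \<alpha> \<mu> 1 = m i / a i" for i
    using geodesic_profile_endpoint[of "m i / a i" \<alpha>] a m by (metis divide_pos_pos)
  then obtain \<mu> where \<mu>: "\<And>i t. t \<in> {0..1} \<Longrightarrow> 0 < 1 + \<alpha> * t * \<mu> i"
    and end1: "\<And>i. geodesic_profile \<alpha> (\<mu> i) 1 = m i / a i"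
    by metis
  let ?\<gamma> = "\<lambda>t. cdiag Y (\<lambda>i. a i * geodesic_profile \<alpha> (\<mu> i) t)"
  have a0: "a i \<noteq> 0" for i using a[of i] by simp
  have mid: "a i * geodesic_profile \<alpha> (\<mu> i) (1/2) = pow_mean \<alpha> (a i) (m i)" for i
    using pow_mean_homogeneous[of "a i" 1 "m i / a i" \<alpha>] geodesic_profile_mid[of \<alpha> "\<mu> i"] \<mu>[of 1 i]
    by (simp add: end1 a m a0)
  show "\<exists>\<gamma>. affine_geodesic (nabla_alpha \<alpha>) \<gamma> \<and> \<gamma> 0 = cdiag Y a \<and> \<gamma> 1 = cdiag Y m
      \<and> \<gamma> (1/2) = cdiag Y (\<lambda>i. pow_mean \<alpha> (a i) (m i))"
    by (intro exI[of _ ?\<gamma>] conjI affine_geodesic_cdiag_profile Y a \<mu>) (simp_all only: mid, simp_all add: end1 a0)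
next
  fix X assume "\<exists>\<gamma>. affine_geodesic (nabla_alpha \<alpha>) \<gamma> \<and> \<gamma> 0 = cdiag Y a \<and> \<gamma> 1 = cdiag Y m
      \<and> \<gamma> (1/2) = X"
  then obtain \<gamma> where geo: "affine_geodesic (nabla_alpha \<alpha>) \<gamma>"
    and ends: "\<gamma> 0 = cdiag Y a" "\<gamma> 1 = cdiag Y m" and X: "\<gamma> (1/2) = X"
    by blast
  obtain Z \<mu> where Z: "invertible Z" and \<mu>: "\<And>i. 0 < 1 + \<alpha> * \<mu> i"
    and \<gamma>: "\<And>t. t \<in> {0..1} \<Longrightarrow> \<gamma> t = cdiag Z (\<lambda>i. geodesic_profile \<alpha> (\<mu> i) t)"
    by (rule affine_geodesic_imp_profile[OF geo]) (rule that)
  let ?l = "\<lambda>i. geodesic_profile \<alpha> (\<mu> i) 1"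
  have l: "0 < ?l i" for i using geodesic_profile_pos[of \<alpha> 1 "\<mu> i"] \<mu>[of i] by simp
  have "cdiag Y (\<lambda>i. pow_mean \<alpha> (a i) (m i)) = cdiag Z (\<lambda>i. pow_mean \<alpha> 1 (?l i))"
  proof (rule cdiag_homogeneous_fun_unique[where F = "pow_mean \<alpha>" and b = "\<lambda>_. 1" and n = ?l, OF Y Z a])
    show "cdiag Y a = cdiag Z (\<lambda>i. 1)" using ends(1) \<gamma>[of 0] by simp
    show "cdiag Y m = cdiag Z ?l" using ends(2) \<gamma>[of 1] by simp
  qed (simp_all only: pow_mean_homogeneous l zero_less_one)
  also have "\<dots> = X"
    using \<gamma>[of "1/2"] \<mu> by (simp add: X geodesic_profile_mid)
  finally show "X = cdiag Y (\<lambda>i. pow_mean \<alpha> (a i) (m i))" by simp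
qed

section \<open>The scalar iteration in logarithmic coordinates\<close>

text \<open>If \<open>g e\<^sup>-\<^sup>x\<close> and \<open>g e\<^sup>x\<close> are the two current values, this is the \<open>x\<close> of the next
  pair. For \<open>\<alpha> = 0\<close> the convention on division by zero makes it 0, in
  accordance with both means being the geometric mean.\<close>

definition half_gap_step :: "real \<Rightarrow> real \<Rightarrow> real" where
  "half_gap_step \<alpha> x = - (ln (cosh (\<alpha> * x)) / \<alpha>)"

text \<open>The average of \<open>e\<^sup>-\<^sup>\<alpha>\<^sup>x\<close> and \<open>e\<^sup>\<alpha>\<^sup>x\<close> is \<open>cosh (\<alpha> x)\<close>, which is even in \<open>\<alpha>\<close>. The
  means with exponents \<open>\<alpha>\<close> and \<open>- \<alpha>\<close> therefore again have product \<open>g\<^sup>2\<close>.\<close>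

lemma pow_mean_exp:
  assumes g: "0 < g"
  shows "pow_mean \<alpha> (g * exp (- x)) (g * exp x) = g * exp (- half_gap_step \<alpha> x)"
proof (cases "\<alpha> = 0")
  case True
  have "g * exp (- x) * (g * exp x) = g\<^sup>2"
    by (simp add: exp_minus power2_eq_square)
  then show ?thesis using g True by (simp add: pow_mean_def half_gap_step_def)
next
  case False
  have "(exp (- x) powr \<alpha> + exp x powr \<alpha>) / 2 = cosh (\<alpha> * x)"
    by (simp add: powr_def cosh_field_def add.commute)
  then have "pow_mean \<alpha> (exp (- x)) (exp x) = cosh (\<alpha> * x) powr (1 / \<alpha>)"
    by (simp only: pow_mean_def False if_False)
  also have "\<dots> = exp (- half_gap_step \<alpha> x)"
    using cosh_real_pos[of "\<alpha> * x"] by (simp add: powr_def half_gap_step_def)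
  finally show ?thesis by (simp add: pow_mean_homogeneous g)
qed

lemma half_gap_step_uminus: "half_gap_step (- \<alpha>) x = - half_gap_step \<alpha> x"
  by (simp add: half_gap_step_def)

lemma half_gap_step_abs: "half_gap_step \<alpha> \<bar>x\<bar> = half_gap_step \<alpha> x"
  by (simp add: half_gap_step_def abs_if)

lemma ln_cosh_nonneg: "0 \<le> ln (cosh x)" for x :: real
  by (simp add: cosh_real_ge_1)

text \<open>\<open>cosh x\<close> is the average of \<open>exp \<bar>x\<bar>\<close> and the smaller number \<open>exp (- \<bar>x\<bar>)\<close>.\<close>

lemma ln_cosh_less_abs:
  fixes x :: real
  assumes "x \<noteq> 0"
  shows "ln (cosh x) < \<bar>x\<bar>"
proof -
  have "cosh x = cosh \<bar>x\<bar>" by simp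
  also have "\<dots> < exp \<bar>x\<bar>"
    using assms by (simp add: cosh_field_def field_simps)
  finally have "ln (cosh x) < ln (exp \<bar>x\<bar>)" by (subst ln_less_cancel_iff) simp_all
  then show ?thesis by simp
qed

text \<open>The derivative \<open>tanh\<close> of \<open>ln cosh\<close> is at most the identity on the positive axis.\<close>

lemma ln_cosh_le: "ln (cosh x) \<le> x\<^sup>2 / 2" for x :: real
proof -
  have tanh: "tanh y \<le> y" if "0 \<le> y" for y :: real
  proof -
    have "0 - tanh 0 \<le> y - tanh y"
    proof (rule DERIV_nonneg_imp_nondecreasing[where f = "\<lambda>y. y - tanh y", OF that])
      fix z :: real
      have "((\<lambda>y. y - tanh y) has_real_derivative (tanh z)\<^sup>2) (at z)"
        by (auto intro!: derivative_eq_intros)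
      then show "\<exists>d. ((\<lambda>y. y - tanh y) has_real_derivative d) (at z) \<and> 0 \<le> d" by auto
    qed
    then show ?thesis by simp
  qed
  have "0\<^sup>2 / 2 - ln (cosh 0) \<le> \<bar>x\<bar>\<^sup>2 / 2 - ln (cosh \<bar>x\<bar>)"
  proof (rule DERIV_nonneg_imp_nondecreasing[where f = "\<lambda>y. y\<^sup>2 / 2 - ln (cosh y)"])
    fix z :: real assume z: "0 \<le> z"
    have "((\<lambda>y. y\<^sup>2 / 2 - ln (cosh y)) has_real_derivative (z - tanh z)) (at z)"
      by (auto intro!: derivative_eq_intros simp: tanh_def)
    then show "\<exists>d. ((\<lambda>y. y\<^sup>2 / 2 - ln (cosh y)) has_real_derivative d) (at z) \<and> 0 \<le> d"
      using tanh[OF z] by auto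
  qed simp
  then show ?thesis by simp
qed

lemma abs_half_gap_step: "\<bar>half_gap_step \<alpha> x\<bar> = ln (cosh (\<alpha> * x)) / \<bar>\<alpha>\<bar>"
  using ln_cosh_nonneg[of "\<alpha> * x"] by (simp add: half_gap_step_def)

lemma abs_half_gap_step_le: "\<bar>half_gap_step \<alpha> x\<bar> \<le> \<bar>\<alpha>\<bar> / 2 * x\<^sup>2"
proof (cases "\<alpha> = 0")
  case False
  have "ln (cosh (\<alpha> * x)) / \<bar>\<alpha>\<bar> \<le> ((\<alpha> * x)\<^sup>2 / 2) / \<bar>\<alpha>\<bar>"
    by (intro divide_right_mono ln_cosh_le) simp
  also have "\<dots> = \<bar>\<alpha>\<bar> / 2 * x\<^sup>2"
    using False by (cases "0 < \<alpha>") (auto simp: power2_eq_square field_simps)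
  finally show ?thesis by (simp only: abs_half_gap_step)
qed (simp add: half_gap_step_def)

lemma abs_half_gap_step_less:
  assumes "x \<noteq> 0"
  shows "\<bar>half_gap_step \<alpha> x\<bar> < \<bar>x\<bar>"
proof (cases "\<alpha> = 0")
  case False
  then have "ln (cosh (\<alpha> * x)) < \<bar>\<alpha>\<bar> * \<bar>x\<bar>"
    using ln_cosh_less_abs[of "\<alpha> * x"] assms by (simp add: abs_mult)
  then show ?thesis using False by (simp add: abs_half_gap_step field_simps)
qed (simp add: half_gap_step_def assms)

text \<open>The absolute values decrease, so they converge; by continuity a step does not shrink their limit,
  and only 0 is not shrunk.\<close>

lemma half_gap_step_tendsto_0: "(\<lambda>n. (half_gap_step \<alpha> ^^ n) x) \<longlonglongrightarrow> 0"
proof -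
  define u where "u n = \<bar>(half_gap_step \<alpha> ^^ n) x\<bar>" for n
  have step: "u (Suc n) = \<bar>half_gap_step \<alpha> (u n)\<bar>" for n
    by (simp add: u_def half_gap_step_abs)
  have le: "\<bar>half_gap_step \<alpha> y\<bar> \<le> \<bar>y\<bar>" for y
    using abs_half_gap_step_less[of y \<alpha>] by (cases "y = 0") (auto simp: half_gap_step_def)
  have "u (Suc n) \<le> u n" for n
    using le[of "(half_gap_step \<alpha> ^^ n) x"] by (simp add: u_def)
  then have "decseq u" by (rule decseq_SucI)
  moreover have "0 \<le> u n" for n by (simp add: u_def)
  ultimately obtain L where L: "u \<longlonglongrightarrow> L" using decseq_convergent by blast
  have "isCont (\<lambda>y. \<bar>half_gap_step \<alpha> y\<bar>) L"
    unfolding half_gap_step_def divide_inverse by (intro continuous_intros) auto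
  then have "(\<lambda>n. \<bar>half_gap_step \<alpha> (u n)\<bar>) \<longlonglongrightarrow> \<bar>half_gap_step \<alpha> L\<bar>"
    using L by (rule isCont_tendsto_compose)
  then have "(\<lambda>n. u (Suc n)) \<longlonglongrightarrow> \<bar>half_gap_step \<alpha> L\<bar>" by (simp only: step)
  then have "\<bar>half_gap_step \<alpha> L\<bar> = L"
    using L LIMSEQ_Suc LIMSEQ_unique by blast
  then have "L = 0" using abs_half_gap_step_less[of L \<alpha>] by fastforce
  then show ?thesis
    using L unfolding u_def[abs_def] by (simp add: tendsto_rabs_zero_iff)
qed

section \<open>The Gauss iteration of the two means\<close>

lemma SPD_pair_diagonalisation:
  fixes P Q :: "real^'m::finite^'m"
  assumes P: "P \<in> SPD" and Q: "Q \<in> SPD"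
  obtains Y l where "invertible Y" "\<And>i. 0 < l i" "P = cdiag Y (\<lambda>_. 1)" "Q = cdiag Y l"
    "\<And>f. spectral_mean f P Q = cdiag Y (\<lambda>i. f (l i))"
proof -
  have sym: "transpose Q = Q" using Q by (simp add: SPD_def)
  obtain Y l where Y: "invertible Y" "P = cdiag Y (\<lambda>_. 1)" "Q = cdiag Y l"
    "\<And>f. spectral_mean f P Q = cdiag Y (\<lambda>i. f (l i))"
    by (rule simultaneous_diagonalisation[OF P sym]) (rule that)
  have l: "0 < l i" for i using SPD_cdiag_pos[OF Y(1)] Q Y(3) by simp
  show thesis using Y(1) l Y(2-4) by (rule that)
qed

text \<open>All iterates are diagonal in one fixed basis, so the matrix iteration is the
  scalar one at each of the numbers \<open>l i\<close>.\<close>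

lemma gauss_sequence_cdiag:
  fixes Y :: "real^'m::finite^'m"
  assumes Y: "invertible Y" and l: "\<And>i. 0 < l i"
    and P: "Pn 0 = cdiag Y (\<lambda>_. 1)" and Q: "Qn 0 = cdiag Y l"
    and Pn: "\<And>n. Pn (Suc n) = A_mean \<alpha> (Pn n) (Qn n)"
    and Qn: "\<And>n. Qn (Suc n) = M_mean \<alpha> (Pn n) (Qn n)"
  shows "Pn n = cdiag Y (\<lambda>i. sqrt (l i) * exp (- (half_gap_step \<alpha> ^^ n) (ln (l i) / 2)))
       \<and> Qn n = cdiag Y (\<lambda>i. sqrt (l i) * exp ((half_gap_step \<alpha> ^^ n) (ln (l i) / 2)))"
proof (induction n)
  case 0
  have "exp (ln (l i) / 2) = sqrt (l i)" for i
    using l[of i] by (simp add: powr_half_sqrt[symmetric] powr_def)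
  moreover have "sqrt (l i) * sqrt (l i) = l i" "sqrt (l i) \<noteq> 0" for i
    using l[of i] by auto
  ultimately show ?case by (simp add: P Q exp_minus)
next
  case (Suc n)
  have "0 < sqrt (l i) * exp z" for i z using l by simp
  then show ?case
    using l by (simp add: Pn Qn Suc A_mean_def M_mean_def midpoint_map_nabla_alpha_cdiag Y
        pow_mean_exp half_gap_step_uminus)
qed

lemma log_coordinate_sequence_tendsto:
  fixes Y :: "real^'m::finite^'m"
  shows "(\<lambda>n. cdiag Y (\<lambda>i. g i * exp (- (half_gap_step \<alpha> ^^ n) (x i)))) \<longlonglongrightarrow> cdiag Y g"
    and "(\<lambda>n. cdiag Y (\<lambda>i. g i * exp ((half_gap_step \<alpha> ^^ n) (x i)))) \<longlonglongrightarrow> cdiag Y g"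
proof -
  have "(\<lambda>n. g i * exp (- (half_gap_step \<alpha> ^^ n) (x i))) \<longlonglongrightarrow> g i * exp (- 0)"
    "(\<lambda>n. g i * exp ((half_gap_step \<alpha> ^^ n) (x i))) \<longlonglongrightarrow> g i * exp 0" for i
    by (intro tendsto_intros half_gap_step_tendsto_0)+
  then show "(\<lambda>n. cdiag Y (\<lambda>i. g i * exp (- (half_gap_step \<alpha> ^^ n) (x i)))) \<longlonglongrightarrow> cdiag Y g"
    "(\<lambda>n. cdiag Y (\<lambda>i. g i * exp ((half_gap_step \<alpha> ^^ n) (x i)))) \<longlonglongrightarrow> cdiag Y g"
    by (auto intro!: tendsto_cdiag)
qed

lemma nabla_alpha_0: "nabla_alpha 0 = nabla_g"
  by (intro ext) (simp add: nabla_alpha_def)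

lemma M_g_eq_geometric_mean:
  fixes P Q :: "real^'m::finite^'m"
  assumes "P \<in> SPD" and "Q \<in> SPD"
  shows "M_g P Q = P \<sharp> Q"
proof -
  obtain Y l where Y: "invertible Y" "\<And>i. 0 < l i" "P = cdiag Y (\<lambda>_. 1)" "Q = cdiag Y l"
    "\<And>f. spectral_mean f P Q = cdiag Y (\<lambda>i. f (l i))"
    by (rule SPD_pair_diagonalisation[OF assms]) (rule that)
  then show ?thesis
    by (simp add: M_g_def nabla_alpha_0[symmetric] midpoint_map_nabla_alpha_cdiag
        geometric_mean_cdiag pow_mean_def)
qed

lemma gauss_sequence_tendsto_geometric_mean:
  fixes P Q :: "real^'m::finite^'m"
  assumes SPD: "P \<in> SPD" "Q \<in> SPD" and 0: "Pn 0 = P" "Qn 0 = Q"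
    and Pn: "\<And>n. Pn (Suc n) = A_mean \<alpha> (Pn n) (Qn n)"
    and Qn: "\<And>n. Qn (Suc n) = M_mean \<alpha> (Pn n) (Qn n)"
  shows "Pn \<longlonglongrightarrow> P \<sharp> Q" and "Qn \<longlonglongrightarrow> P \<sharp> Q"
proof -
  obtain Y l where Y: "invertible Y" "\<And>i. 0 < l i" "P = cdiag Y (\<lambda>_. 1)" "Q = cdiag Y l"
    "\<And>f. spectral_mean f P Q = cdiag Y (\<lambda>i. f (l i))"
    by (rule SPD_pair_diagonalisation[OF SPD]) (rule that)
  let ?g = "\<lambda>i. sqrt (l i)" and ?x = "\<lambda>n i. (half_gap_step \<alpha> ^^ n) (ln (l i) / 2)"
  have "Pn n = cdiag Y (\<lambda>i. ?g i * exp (- ?x n i)) \<and> Qn n = cdiag Y (\<lambda>i. ?g i * exp (?x n i))" for n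
    by (rule gauss_sequence_cdiag[where Pn = Pn and Qn = Qn, OF Y(1,2) _ _ Pn Qn]) (simp_all add: 0 Y(3,4))
  then have "Pn = (\<lambda>n. cdiag Y (\<lambda>i. ?g i * exp (- ?x n i)))"
    "Qn = (\<lambda>n. cdiag Y (\<lambda>i. ?g i * exp (?x n i)))" by blast+
  moreover have "P \<sharp> Q = cdiag Y ?g"
    by (simp add: Y geometric_mean_cdiag)
  ultimately show "Pn \<longlonglongrightarrow> P \<sharp> Q" "Qn \<longlonglongrightarrow> P \<sharp> Q"
    using log_coordinate_sequence_tendsto[of Y ?g \<alpha> "\<lambda>i. ln (l i) / 2"] by simp_all
qed

lemma gauss_composition_eq_M_g:
  fixes P Q :: "real^'m::finite^'m"
  assumes SPD: "P \<in> SPD" "Q \<in> SPD"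
  shows "has_gauss_composition (A_mean \<alpha>) (M_mean \<alpha>) P Q (M_g P Q)"
    and "gauss_composition (A_mean \<alpha>) (M_mean \<alpha>) P Q = M_g P Q"
proof -
  let ?P = "\<lambda>n. fst (gauss_iter (A_mean \<alpha>) (M_mean \<alpha>) P Q n)"
  let ?Q = "\<lambda>n. snd (gauss_iter (A_mean \<alpha>) (M_mean \<alpha>) P Q n)"
  have "?P (Suc n) = A_mean \<alpha> (?P n) (?Q n)" "?Q (Suc n) = M_mean \<alpha> (?P n) (?Q n)" for n
    by (simp_all add: case_prod_unfold Let_def)
  then show *: "has_gauss_composition (A_mean \<alpha>) (M_mean \<alpha>) P Q (M_g P Q)"
    unfolding has_gauss_composition_def M_g_eq_geometric_mean[OF SPD]
    using gauss_sequence_tendsto_geometric_mean[OF SPD, of ?P ?Q \<alpha>] by simp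
  then show "gauss_composition (A_mean \<alpha>) (M_mean \<alpha>) P Q = M_g P Q"
    unfolding gauss_composition_def
    by (intro the_equality) (auto simp: has_gauss_composition_def intro: LIMSEQ_unique)
qed

text \<open>The entry at which the new maximum is attained was bounded by the old maximum, so entrywise
  estimates pass to the maxima.\<close>

lemma Max_abs_decrease:
  fixes x y :: "'i::finite \<Rightarrow> real"
  assumes "\<And>i. \<bar>y i\<bar> \<le> c * (x i)\<^sup>2" "0 \<le> c"
    and "\<And>i. x i = 0 \<Longrightarrow> y i = 0" "\<And>i. x i \<noteq> 0 \<Longrightarrow> \<bar>y i\<bar> < \<bar>x i\<bar>"
  shows "Max (range (\<lambda>i. \<bar>y i\<bar>)) \<le> c * (Max (range (\<lambda>i. \<bar>x i\<bar>)))\<^sup>2"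
    and "0 < Max (range (\<lambda>i. \<bar>x i\<bar>)) \<Longrightarrow> Max (range (\<lambda>i. \<bar>y i\<bar>)) < Max (range (\<lambda>i. \<bar>x i\<bar>))"
proof -
  have le: "\<bar>x i\<bar> \<le> Max (range (\<lambda>i. \<bar>x i\<bar>))" for i by (intro Max_ge) auto
  have "Max (range (\<lambda>i. \<bar>y i\<bar>)) \<in> range (\<lambda>i. \<bar>y i\<bar>)" by (intro Max_in) auto
  then obtain j where j: "Max (range (\<lambda>i. \<bar>y i\<bar>)) = \<bar>y j\<bar>" by (rule rangeE)
  have "(x j)\<^sup>2 \<le> (Max (range (\<lambda>i. \<bar>x i\<bar>)))\<^sup>2" using power_mono[OF le[of j], of 2] by simp
  then show "Max (range (\<lambda>i. \<bar>y i\<bar>)) \<le> c * (Max (range (\<lambda>i. \<bar>x i\<bar>)))\<^sup>2"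
    unfolding j using assms(1)[of j] assms(2) by (meson mult_left_mono order_trans)
  show "Max (range (\<lambda>i. \<bar>y i\<bar>)) < Max (range (\<lambda>i. \<bar>x i\<bar>))" if "0 < Max (range (\<lambda>i. \<bar>x i\<bar>))"
    unfolding j using that assms(3,4)[of j] le[of j] by (cases "x j = 0") (simp, linarith)
qed

text \<open>The eigenvalues are the numbers \<open>exp (2 * x i)\<close>, and the factor 1/2 cancels this 2.\<close>

lemma max_log_eigenvalue_log_coordinates:
  fixes Y :: "real^'m::finite^'m"
  assumes Y: "invertible Y" and g: "\<And>i. 0 < g i"
  shows "1/2 * Max ((\<lambda>l. \<bar>ln l\<bar>) ` eigenvalues (matrix_inv (cdiag Y (\<lambda>i. g i * exp (- x i)))
      ** cdiag Y (\<lambda>i. g i * exp (x i)))) = Max (range (\<lambda>i. \<bar>x i\<bar>))"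
proof -
  have g0: "g i \<noteq> 0" for i using g[of i] by simp
  have gap: "\<bar>ln (g i * exp (x i) / (g i * exp (- x i)))\<bar> = 2 * \<bar>x i\<bar>" for i
  proof -
    have "g i * exp (x i) / (g i * exp (- x i)) = exp (x i) / exp (- x i)"
      using g0[of i] by (rule mult_divide_mult_cancel_left)
    also have "\<dots> = exp (x i - - x i)" by (rule exp_diff[symmetric])
    finally show ?thesis by simp
  qed
  have "eigenvalues (matrix_inv (cdiag Y (\<lambda>i. g i * exp (- x i))) ** cdiag Y (\<lambda>i. g i * exp (x i)))
      = range (\<lambda>i. g i * exp (x i) / (g i * exp (- x i)))"
    by (rule eigenvalues_cdiag[OF Y]) (simp add: g0)
  then have "(\<lambda>l. \<bar>ln l\<bar>) ` eigenvalues (matrix_inv (cdiag Y (\<lambda>i. g i * exp (- x i)))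
      ** cdiag Y (\<lambda>i. g i * exp (x i))) = (\<lambda>z. 2 * z) ` range (\<lambda>i. \<bar>x i\<bar>)"
    by (simp only: image_image gap)
  also have "Max \<dots> = 2 * Max (range (\<lambda>i. \<bar>x i\<bar>))"
    by (rule mono_Max_commute[symmetric]) (auto simp: mono_def)
  finally show ?thesis by simp
qed

theorem proposition5p1:
  fixes \<alpha> :: real
    and P Q S :: "real^'m::finite^'m"
    and Pn Qn :: "nat \<Rightarrow> real^'m^'m"
    and a m :: "nat \<Rightarrow> real \<Rightarrow> real"
    and \<delta> :: "nat \<Rightarrow> real"
  assumes "P \<in> SPD" and "Q \<in> SPD"
    and "S = spd_powr P (- (1/2)) ** Q ** spd_powr P (- (1/2))"
    and "Pn 0 = P" and "Qn 0 = Q"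
    and "\<And>n. Pn (Suc n) = A_mean \<alpha> (Pn n) (Qn n)"
    and "\<And>n. Qn (Suc n) = M_mean \<alpha> (Pn n) (Qn n)"
    and "\<And>x. x > 0 \<Longrightarrow> a 0 x = 1" and "\<And>x. x > 0 \<Longrightarrow> m 0 x = x"
    and "\<And>n x. \<alpha> \<noteq> 0 \<Longrightarrow> x > 0 \<Longrightarrow>
           a (Suc n) x = ((a n x powr \<alpha> + m n x powr \<alpha>) / 2) powr (1 / \<alpha>)"
    and "\<And>n x. \<alpha> \<noteq> 0 \<Longrightarrow> x > 0 \<Longrightarrow>
           m (Suc n) x = ((a n x powr (- \<alpha>) + m n x powr (- \<alpha>)) / 2) powr (- (1 / \<alpha>))"
    and "\<And>n x. \<alpha> = 0 \<Longrightarrow> x > 0 \<Longrightarrow> a (Suc n) x = sqrt (a n x * m n x)"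
    and "\<And>n x. \<alpha> = 0 \<Longrightarrow> x > 0 \<Longrightarrow> m (Suc n) x = sqrt (a n x * m n x)"
    and "\<And>n. \<delta> n = 1/2 * Max ((\<lambda>l. \<bar>ln l\<bar>) ` eigenvalues (matrix_inv (Pn n) ** Qn n))"
  shows "(\<forall>n. Pn n \<sharp> Qn n = P \<sharp> Q)
    \<and> (\<forall>n. Pn n = spd_powr P (1/2) ** spectral_fun (a n) S ** spd_powr P (1/2)
         \<and> Qn n = spd_powr P (1/2) ** spectral_fun (m n) S ** spd_powr P (1/2))
    \<and> (\<forall>n. \<delta> (Suc n) \<le> \<bar>\<alpha>\<bar> / 2 * (\<delta> n)^2)
    \<and> (\<forall>n. \<delta> n > 0 \<longrightarrow> \<delta> (Suc n) < \<delta> n)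
    \<and> Pn \<longlonglongrightarrow> P \<sharp> Q \<and> Qn \<longlonglongrightarrow> P \<sharp> Q
    \<and> (\<forall>P'\<in>(SPD :: (real^'m^'m) set). \<forall>Q'\<in>(SPD :: (real^'m^'m) set).
         has_gauss_composition (A_mean \<alpha>) (M_mean \<alpha>) P' Q' (M_g P' Q')
       \<and> gauss_composition (A_mean \<alpha>) (M_mean \<alpha>) P' Q' = M_g P' Q')"
proof -
  have SPD: "P \<in> SPD" "Q \<in> SPD" by fact+
  obtain Y l where Y: "invertible Y" "\<And>i. 0 < l i" "P = cdiag Y (\<lambda>_. 1)" "Q = cdiag Y l"
    "\<And>f. spectral_mean f P Q = cdiag Y (\<lambda>i. f (l i))"
    by (rule SPD_pair_diagonalisation[OF SPD]) (rule that)
  \<comment> \<open>In the basis \<open>Y\<close> the iterates are \<open>g e\<^sup>-\<^sup>x\<close> and \<open>g e\<^sup>x\<close>, where only \<open>x\<close> changes.\<close>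
  define g where "g i = sqrt (l i)" for i
  define x where "x n i = (half_gap_step \<alpha> ^^ n) (ln (l i) / 2)" for n i
  have g: "0 < g i" for i using Y(2) by (simp add: g_def)
  have x_Suc: "x (Suc n) i = half_gap_step \<alpha> (x n i)" for n i by (simp add: x_def)
  have seq: "Pn n = cdiag Y (\<lambda>i. g i * exp (- x n i))" "Qn n = cdiag Y (\<lambda>i. g i * exp (x n i))" for n
  proof -
    have "Pn 0 = cdiag Y (\<lambda>_. 1)" "Qn 0 = cdiag Y l" by (simp_all only: assms(4,5) Y(3,4))
    from gauss_sequence_cdiag[where Pn = Pn and Qn = Qn and n = n and l = l, OF Y(1,2) this assms(6,7)]
    show "Pn n = cdiag Y (\<lambda>i. g i * exp (- x n i))" "Qn n = cdiag Y (\<lambda>i. g i * exp (x n i))"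
      unfolding g_def x_def by blast+
  qed

  have a_Suc: "a (Suc n) z = pow_mean \<alpha> (a n z) (m n z)"
    and m_Suc: "m (Suc n) z = pow_mean (- \<alpha>) (a n z) (m n z)" if "0 < z" for n z
    using assms(10-13)[OF _ that] by (cases "\<alpha> = 0"; simp add: pow_mean_def)+
  have am: "a n (l i) = g i * exp (- x n i) \<and> m n (l i) = g i * exp (x n i)" for n i
  proof (induction n)
    case 0
    have "exp (x 0 i) = g i"
      using Y(2)[of i] by (simp add: x_def g_def powr_half_sqrt[symmetric] powr_def)
    moreover have "g i * g i = l i" "g i \<noteq> 0" using Y(2)[of i] by (auto simp: g_def)
    ultimately show ?case using assms(8,9)[of "l i"] Y(2) by (simp add: exp_minus)
  next
    case (Suc n)
    then show ?case
      using a_Suc[OF Y(2)] m_Suc[OF Y(2)] pow_mean_exp[OF g, of \<alpha> i] pow_mean_exp[OF g, of "- \<alpha>" i]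
      by (simp add: x_Suc half_gap_step_uminus)
  qed
  have calculus: "spd_powr P (1/2) ** spectral_fun f S ** spd_powr P (1/2) = cdiag Y (\<lambda>i. f (l i))" for f
    using Y(5)[of f] by (simp add: spectral_mean_def assms(3))

  have mean: "Pn n \<sharp> Qn n = cdiag Y g" for n
  proof -
    have "g i * exp (- x n i) * (g i * exp (x n i)) = (g i)\<^sup>2" for i
      by (simp add: exp_minus power2_eq_square)
    then have "sqrt (g i * exp (- x n i) * (g i * exp (x n i))) = g i" for i
      using g[of i] by simp
    then show ?thesis using g by (simp add: seq geometric_mean_cdiag Y(1))
  qed
  have \<delta>: "\<delta> n = Max (range (\<lambda>i. \<bar>x n i\<bar>))" for n
    unfolding assms(14) seq by (rule max_log_eigenvalue_log_coordinates[OF Y(1) g])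
  have decrease: "\<bar>x (Suc n) i\<bar> \<le> \<bar>\<alpha>\<bar> / 2 * (x n i)\<^sup>2"
    "x n i = 0 \<Longrightarrow> x (Suc n) i = 0" "x n i \<noteq> 0 \<Longrightarrow> \<bar>x (Suc n) i\<bar> < \<bar>x n i\<bar>" for n i
    unfolding x_Suc by (rule abs_half_gap_step_le, simp add: half_gap_step_def, rule abs_half_gap_step_less)

  show ?thesis
  proof (intro conjI allI ballI impI)
    show "Pn n \<sharp> Qn n = P \<sharp> Q" for n
      using mean[of n] mean[of 0] assms(4,5) by simp
    show "Pn n = spd_powr P (1/2) ** spectral_fun (a n) S ** spd_powr P (1/2)"
      "Qn n = spd_powr P (1/2) ** spectral_fun (m n) S ** spd_powr P (1/2)" for n
      by (simp_all add: seq calculus am)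
    show "\<delta> (Suc n) \<le> \<bar>\<alpha>\<bar> / 2 * (\<delta> n)^2" for n
      unfolding \<delta> by (rule Max_abs_decrease(1)[where x = "x n" and y = "x (Suc n)", OF decrease(1) _ decrease(2,3)]) simp
    show "\<delta> (Suc n) < \<delta> n" if "\<delta> n > 0" for n
      using that unfolding \<delta>
      by (intro Max_abs_decrease(2)[where x = "x n" and y = "x (Suc n)", OF decrease(1) _ decrease(2,3)]) simp_all
    show "Pn \<longlonglongrightarrow> P \<sharp> Q" "Qn \<longlonglongrightarrow> P \<sharp> Q"
      by (rule gauss_sequence_tendsto_geometric_mean[OF SPD assms(4-7)])+
  qed (rule gauss_composition_eq_M_g; assumption)+
qed

end
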